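(* Let $\widetilde a,\widetilde b$ be either both real in $[0,\infty)$, or a complex conjugate pair with $\operatorname{Re}(\widetilde a)\ge0$. Let $x\in\mathbb R$, and for $M>0$ put $$m=\lfloor Mx\rfloor+\left\lfloor M\log\left(M\sqrt{(1+\widetilde a)(1+\widetilde b)}\right)\right\rfloor,\qquad q_M=e^{-2/M},\qquad a_M=-q_M\widetilde a,\qquad b_M=-q_M\widetilde b .$$ Then for every $u\in\mathbb R$, $$\lim_{M\to\infty}\frac{(q_M;q_M)_\infty^2}{M\,(a_M;q_M)_\infty(b_M;q_M)_\infty}\;\frac{Q_m(\cos(u/M);a_M,b_M\mid q_M)}{(q_M;q_M)_m}=K_{\mathrm i|u|}(e^{-x}).$$
   Context: $q$-Pochhammer symbols: $(a;q)_n=\prod_{k=0}^{n-1}(1-aq^k)$, $(a;q)_\infty=\prod_{k=0}^\infty(1-aq^k)$. The Al-Salam--Chihara polynomials $Q_n(x;a,b|q)$ are defined by $Q_{-1}\equiv0$, $Q_0\equiv1$ and $$2xQ_n(x;a,b|q)=Q_{n+1}(x;a,b|q)+(a+b)q^nQ_n(x;a,b|q)+(1-q^n)(1-abq^{n-1})Q_{n-1}(x;a,b|q),\quad n\ge0.$$ $K_\nu(z)$ is the modified Bessel function of the second kind (Macdonald function), for $z>0$ given by $K_\nu(z)=\int_0^\infty e^{-z\cosh w}\cosh(\nu w)\,dw$. Note that $m$ is a non-negative integer for $M$ large enough. *)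

theory Defs
  imports "HOL-Analysis.Analysis"
begin

definition qpoch :: "complex \<Rightarrow> complex \<Rightarrow> nat \<Rightarrow> complex" where
  "qpoch a q n = (\<Prod>k<n. 1 - a * q ^ k)"

definition qpoch_inf :: "complex \<Rightarrow> complex \<Rightarrow> complex" where
  "qpoch_inf a q = (\<Prod>k. 1 - a * q ^ k)"

text \<open>
  The three-term recurrence solved for its leading term. At \<open>n = 0\<close> the factor \<open>1 - q ^ n\<close>
  vanishes, so the convention \<open>Q\<^sub>-\<^sub>1 = 0\<close> needs no index \<open>-1\<close>;
  the lemma below gives the recurrence in its usual form.
\<close>
fun al_salam_chihara :: "nat \<Rightarrow> complex \<Rightarrow> complex \<Rightarrow> complex \<Rightarrow> complex \<Rightarrow> complex" where
  "al_salam_chihara 0 x a b q = 1"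
| "al_salam_chihara (Suc 0) x a b q = 2 * x - (a + b)"
| "al_salam_chihara (Suc (Suc n)) x a b q =
     (2 * x - (a + b) * q ^ Suc n) * al_salam_chihara (Suc n) x a b q
     - (1 - q ^ Suc n) * (1 - a * b * q ^ n) * al_salam_chihara n x a b q"

lemma al_salam_chihara_recurrence:
  "2 * x * al_salam_chihara n x a b q =
     al_salam_chihara (Suc n) x a b q + (a + b) * q ^ n * al_salam_chihara n x a b q
     + (1 - q ^ n) * (1 - a * b * q powi (int n - 1))
       * (if n = 0 then 0 else al_salam_chihara (n - 1) x a b q)"
  by (cases n) (simp_all add: algebra_simps)

text \<open>The Macdonald function of complex order, for \<open>z > 0\<close> only.\<close>
definition bessel_K :: "complex \<Rightarrow> real \<Rightarrow> complex" where
  "bessel_K \<nu> z =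
     integral {0..} (\<lambda>w::real. complex_of_real (exp (- z * cosh w)) * cosh (\<nu> * complex_of_real w))"

text \<open>
  For the parameters of interest \<open>(1 + a) * (1 + b)\<close> is a positive real, so \<open>Re\<close> only
  changes its type. The index is a natural number as soon as the integer under \<open>nat\<close> is
  nonnegative, which holds for all large \<open>M\<close>.
\<close>
definition scaled_index :: "complex \<Rightarrow> complex \<Rightarrow> real \<Rightarrow> real \<Rightarrow> nat" where
  "scaled_index a b x M =
     nat (\<lfloor>M * x\<rfloor> + \<lfloor>M * ln (M * sqrt (Re ((1 + a) * (1 + b))))\<rfloor>)"

end

theory Submission
  imports
    Defs
    "HOL-Complex_Analysis.Complex_Analysis"
    "HOL-Real_Asymp.Real_Asymp"
    "HOL-Probability.Sinc_Integral"
begin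

text \<open>
  The \<open>q\<close>-binomial theorem turns the generating function of the polynomials into a finite sum
  over \<open>j \<le> m\<close> of products of \<open>q\<close>-shifted factorials with phase \<open>e\<^bsup>iu(2j-m)/M\<^esup>\<close>.
  After normalisation, and with \<open>2j = Mw + m\<close>, the summand converges to
  \<open>exp(iu(w - d) - e\<^bsup>-x\<^esup> cosh(w - d))\<close>, where \<open>d = (Ln(1 + a) - Ln(1 + b))/2\<close>, under a bound of
  the form \<open>C exp(-c cosh w)\<close>. The sum is a Riemann sum of mesh \<open>2/M\<close>, so dominated
  convergence gives half the integral of this function over the line. For real parameters \<open>d\<close> is
  a translation; for a conjugate pair it is imaginary with \<open>\<bar>Im d\<bar> < \<pi>/2\<close> and is removed by
  moving the line of integration.
\<close>

section \<open>Infinite products as the base tends to one\<close>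

text \<open>The size of \<open>m\<close> is what makes both ends of the sum visible at once: for
  \<open>2j = Mw + m\<close> both \<open>M * q^j\<close> and \<open>M * q^(m-j)\<close> have finite
  limits, proportional to \<open>exp (-w)\<close> and \<open>exp w\<close>. An infinite product with
  parameter of order 1/M consists of factors 1 + O(1/M) with geometrically decaying corrections, so
  it tends to an exponential; the two tails of this kind produce the cosh. The obstacle is the
  product \<open>(a_M; q)_inf\<close>, whose first factors are near 1 + a rather than near 1. It is
  therefore always compared with the product whose parameter carries the extra factor
  \<open>exp (-iu/M)\<close> (for b: \<open>exp (iu/M)\<close>): the quotient again has factors 1 +
  O(1/M), and its limit contains the logarithms that make up d. The condition Re a >= 0 acts twice:
  |1 + a q^k| >= 1 bounds these quotients, and arguments below pi/2 keep principal logarithms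
  additive and d inside the strip where the kernel decays. Both kinds of parameters enter the
  analysis only through the nonnegative real parts and the reality of
  \<open>Ln (1 + a) + Ln (1 + b)\<close>.\<close>

definition base :: "real \<Rightarrow> real" where
  "base M = exp (- 2 / M)"

lemma base_pos [simp]: "0 < base M" "0 \<le> base M" "base M \<noteq> 0" "\<bar>base M\<bar> = base M"
  by (simp_all add: base_def)

lemma base_bounds:
  assumes "M > 0"
  shows "0 < base M" "base M < 1" "norm (complex_of_real (base M)) < 1"
  using assms by (auto simp: base_def)

lemma summable_geometric_bound:
  fixes X :: "nat \<Rightarrow> complex"
  assumes "\<And>k. norm (X k) \<le> C * q ^ k" "0 \<le> q" "q < 1"
  shows "summable (\<lambda>k. norm (X k))"
proof (rule summable_comparison_test)
  show "\<exists>N. \<forall>n\<ge>N. norm (norm (X n)) \<le> C * q ^ n" using assms by auto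
  show "summable (\<lambda>n. C * q ^ n)" using assms by (intro summable_mult summable_geometric) auto
qed

text \<open>Linearising each logarithm costs the square of its term, and the squares are dominated
  by a geometric series of ratio q^2. With C and 1 - q both of order 1/M the total cost is of order
  1/M, hence negligible in the limit.\<close>

lemma suminf_Ln_approx:
  fixes X :: "nat \<Rightarrow> complex"
  assumes bnd: "\<And>k. norm (X k) \<le> C * q ^ k" and C: "C \<le> 1 / 2" and q: "0 \<le> q" "q < 1"
  shows "norm ((\<Sum>k. Ln (1 + X k)) - (\<Sum>k. X k)) \<le> 2 * C\<^sup>2 / (1 - q\<^sup>2)"
    and "summable (\<lambda>k. Ln (1 + X k))" "\<And>k. 1 + X k \<noteq> 0"
proof -
  have C0: "0 \<le> C" using bnd[of 0] norm_ge_zero[of "X 0"] by (simp del: norm_ge_zero)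
  have half: "norm (X k) \<le> 1 / 2" for k
  proof -
    have "C * q ^ k \<le> C * 1" using C0 q by (intro mult_left_mono power_le_one) auto
    then show ?thesis using bnd[of k] C by simp
  qed
  show "1 + X k \<noteq> 0" for k
  proof
    assume "1 + X k = 0"
    then have "X k = - 1" by (simp add: eq_neg_iff_add_eq_0 add.commute)
    then show False using half[of k] by simp
  qed
  have sX: "summable X"
    using summable_geometric_bound[OF bnd q] by (rule summable_norm_cancel)
  have q2: "q\<^sup>2 < 1" using q by (simp add: power_less_one_iff)
  have err: "norm (Ln (1 + X k) - X k) \<le> 2 * C\<^sup>2 * (q\<^sup>2) ^ k" for k
  proof -
    have "norm (Ln (1 + X k) - X k) \<le> norm (X k) ^ 2 / (1 - norm (X k))"
      using half[of k] by (intro Ln_approx_linear) auto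
    also have "\<dots> \<le> norm (X k) ^ 2 / (1 / 2)"
      using half[of k] by (intro divide_left_mono) auto
    also have "\<dots> = 2 * norm (X k) ^ 2" by simp
    also have "\<dots> \<le> 2 * (C * q ^ k) ^ 2"
      using bnd[of k] by (intro mult_left_mono power_mono) auto
    finally show ?thesis by (simp add: power_mult_distrib power_mult[symmetric] mult_ac)
  qed
  have s1: "summable (\<lambda>k. norm (Ln (1 + X k) - X k))"
    using summable_geometric_bound[of _ "2 * C\<^sup>2" "q\<^sup>2", OF err] q2 by simp
  have s2: "summable (\<lambda>k. Ln (1 + X k) - X k)" using s1 by (rule summable_norm_cancel)
  from summable_add[OF s2 sX] show sL: "summable (\<lambda>k. Ln (1 + X k))" by simp
  have "(\<Sum>k. Ln (1 + X k)) - (\<Sum>k. X k) = (\<Sum>k. Ln (1 + X k) - X k)"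
    by (rule suminf_diff[OF sL sX])
  also have "norm \<dots> \<le> (\<Sum>k. norm (Ln (1 + X k) - X k))" by (rule summable_norm[OF s1])
  also have "\<dots> \<le> (\<Sum>k. 2 * C\<^sup>2 * (q\<^sup>2) ^ k)"
    using q2 by (intro suminf_le err s1 summable_mult summable_geometric) auto
  also have "\<dots> = 2 * C\<^sup>2 / (1 - q\<^sup>2)"
    using q2 by (subst suminf_mult) (auto simp: suminf_geometric summable_geometric)
  finally show "norm ((\<Sum>k. Ln (1 + X k)) - (\<Sum>k. X k)) \<le> 2 * C\<^sup>2 / (1 - q\<^sup>2)" .
qed

lemma suminf_Ln_tendsto:
  fixes X :: "real \<Rightarrow> nat \<Rightarrow> complex"
  assumes bnd: "eventually (\<lambda>M. \<forall>k. norm (X M k) \<le> C / M * base M ^ k) at_top"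
  shows "((\<lambda>M. (\<Sum>k. Ln (1 + X M k)) - (\<Sum>k. X M k)) \<longlongrightarrow> 0) at_top"
proof (rule Lim_null_comparison)
  have "((\<lambda>M::real. 2 * C\<^sup>2 * (1 / (M\<^sup>2 * (1 - (base M)\<^sup>2)))) \<longlongrightarrow> 0) at_top"
    unfolding base_def by (rule tendsto_mult_right_zero) real_asymp
  then show "((\<lambda>M::real. 2 * (C / M)\<^sup>2 / (1 - (base M)\<^sup>2)) \<longlongrightarrow> 0) at_top"
    by (simp add: power_divide)
  have "eventually (\<lambda>M::real. C / M \<le> 1 / 2) at_top" by real_asymp
  with bnd eventually_gt_at_top[of 0]
  show "\<forall>\<^sub>F M in at_top. norm ((\<Sum>k. Ln (1 + X M k)) - (\<Sum>k. X M k)) \<le> 2 * (C / M)\<^sup>2 / (1 - (base M)\<^sup>2)"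
  proof eventually_elim
    case (elim M)
    then show ?case using base_bounds[of M]
      by (intro suminf_Ln_approx(1)) auto
  qed
qed

text \<open>Exponentiating the sum of logarithms recovers the product whatever the branches, so an
  application only has to compute the limit of the plain sum of the perturbations.\<close>

lemma prodinf_tendsto_exp:
  fixes X :: "real \<Rightarrow> nat \<Rightarrow> complex"
  assumes bnd: "eventually (\<lambda>M. \<forall>k. norm (X M k) \<le> C / M * base M ^ k) at_top"
    and lim: "((\<lambda>M. \<Sum>k. X M k) \<longlongrightarrow> S) at_top"
  shows "((\<lambda>M. \<Prod>k. 1 + X M k) \<longlongrightarrow> exp S) at_top"
proof -
  have "((\<lambda>M. (\<Sum>k. Ln (1 + X M k))) \<longlongrightarrow> S) at_top"
    using tendsto_add[OF suminf_Ln_tendsto[OF bnd] lim] by simp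
  then have 1: "((\<lambda>M. exp (\<Sum>k. Ln (1 + X M k))) \<longlongrightarrow> exp S) at_top" by (rule tendsto_exp)
  have "eventually (\<lambda>M::real. C / M \<le> 1 / 2) at_top" by real_asymp
  with bnd eventually_gt_at_top[of 0]
  have "\<forall>\<^sub>F M in at_top. exp (\<Sum>k. Ln (1 + X M k)) = (\<Prod>k. 1 + X M k)"
  proof eventually_elim
    case (elim M)
    have s: "summable (\<lambda>k. Ln (1 + X M k))" and nz: "\<And>k. 1 + X M k \<noteq> 0"
      using suminf_Ln_approx(2,3)[of "X M" "C / M" "base M"] elim base_bounds[of M] by auto
    show ?case using prodinf_exp[OF s] nz by simp
  qed
  with 1 show ?thesis by (rule Lim_transform_eventually)
qed

section \<open>Infinite q-shifted factorials: convergence, splitting, small parameters\<close>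

lemma qpoch_inf_convergent:
  fixes z q :: complex
  assumes "norm q < 1"
  shows "convergent_prod (\<lambda>k. 1 - z * q ^ k)"
proof -
  have "summable (\<lambda>k. norm ((1 - z * q ^ k) - 1))"
    using summable_geometric_bound[of "\<lambda>k. (1 - z * q ^ k) - 1" "norm z" "norm q"] assms
    by (simp add: norm_mult norm_power)
  then show ?thesis
    by (intro abs_convergent_prod_imp_convergent_prod summable_imp_abs_convergent_prod)
qed

lemma qpoch_LIMSEQ:
  assumes "norm q < 1"
  shows "qpoch z q \<longlonglongrightarrow> qpoch_inf z q"
  using convergent_prod_LIMSEQ[OF qpoch_inf_convergent[OF assms, of z]]
  by (simp add: qpoch_inf_def qpoch_def[abs_def] LIMSEQ_lessThan_iff_atMost)

text \<open>This trades a finite symbol for a quotient of two infinite ones, which is how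
  \<open>qpoch z q j\<close> is handled when j grows with M.\<close>

lemma qpoch_inf_split:
  assumes "norm q < 1"
  shows "qpoch_inf z q = qpoch z q n * qpoch_inf (z * q ^ n) q"
proof -
  have lim: "(\<lambda>N. \<Prod>k<N. 1 - w * q ^ k) \<longlonglongrightarrow> qpoch_inf w q" for w
    using qpoch_LIMSEQ[OF assms, of w] by (simp add: qpoch_def[abs_def])
  have "(\<lambda>N. \<Prod>k<N + n. 1 - z * q ^ k) \<longlonglongrightarrow> qpoch_inf z q"
    using lim by (rule LIMSEQ_ignore_initial_segment)
  moreover have "(\<Prod>k<N + n. 1 - z * q ^ k) = qpoch z q n * (\<Prod>k<N. 1 - (z * q ^ n) * q ^ k)" for N
    by (induction N) (simp_all add: qpoch_def power_add mult_ac)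
  ultimately have "(\<lambda>N. qpoch z q n * (\<Prod>k<N. 1 - (z * q ^ n) * q ^ k)) \<longlonglongrightarrow> qpoch_inf z q"
    by simp
  moreover have "(\<lambda>N. qpoch z q n * (\<Prod>k<N. 1 - (z * q ^ n) * q ^ k)) \<longlonglongrightarrow> qpoch z q n * qpoch_inf (z * q ^ n) q"
    by (intro tendsto_intros lim)
  ultimately show ?thesis by (rule LIMSEQ_unique)
qed

text \<open>The perturbations form a geometric series with sum -z/(1 - q), and M (1 - q) tends to 2
  because q = exp(-2/M). This is the origin of the factor 1/2.\<close>

lemma qpoch_inf_tendsto:
  fixes z :: "real \<Rightarrow> complex"
  assumes lim: "((\<lambda>M. of_real M * z M) \<longlongrightarrow> c) at_top"
  shows "((\<lambda>M. qpoch_inf (z M) (of_real (base M))) \<longlongrightarrow> exp (- c / 2)) at_top"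
proof -
  define C where "C = norm c + 1"
  have "eventually (\<lambda>M. norm (of_real M * z M) < C) at_top"
    using tendsto_norm[OF lim] by (rule order_tendstoD) (simp add: C_def)
  with eventually_gt_at_top[of 0]
  have bnd: "eventually (\<lambda>M. \<forall>k. norm (- z M * of_real (base M) ^ k) \<le> C / M * base M ^ k) at_top"
  proof eventually_elim
    case (elim M)
    then have "norm (z M) \<le> C / M" by (simp add: norm_mult field_simps)
    then have "norm (z M) * base M ^ k \<le> C / M * base M ^ k" for k by (intro mult_right_mono) auto
    then show ?case by (simp add: norm_mult norm_power)
  qed
  have 1: "((\<lambda>M. - (of_real M * z M) * of_real (1 / (M * (1 - base M)))) \<longlongrightarrow> - c * of_real (1 / 2)) at_top"
    unfolding base_def by (intro tendsto_mult tendsto_minus tendsto_of_real lim) real_asymp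
  have ev: "\<forall>\<^sub>F M in at_top. - (of_real M * z M) * of_real (1 / (M * (1 - base M))) = (\<Sum>k. - z M * of_real (base M) ^ k)"
    using eventually_gt_at_top[of 0]
  proof eventually_elim
    case (elim M)
    have "(\<Sum>k. - z M * of_real (base M) ^ k) = - z M * (1 / (1 - of_real (base M)))"
      using base_bounds[OF elim] by (subst suminf_mult) (auto simp: suminf_geometric summable_geometric)
    then show ?case using elim by simp
  qed
  have "((\<lambda>M. \<Sum>k. - z M * of_real (base M) ^ k) \<longlongrightarrow> - c / 2) at_top"
    using Lim_transform_eventually[OF 1 ev] by simp
  from prodinf_tendsto_exp[OF bnd this] show ?thesis by (simp add: qpoch_inf_def)
qed

section \<open>Logarithms on the right half-plane\<close>

lemma Re_1_plus_ge:
  assumes "0 \<le> Re a" "0 \<le> t"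
  shows "1 \<le> Re (1 + a * of_real t)" "1 \<le> norm (1 + a * of_real t)"
proof -
  show 1: "1 \<le> Re (1 + a * of_real t)" using assms by simp
  then show "1 \<le> norm (1 + a * of_real t)" using complex_Re_le_cmod order_trans by blast
qed

text \<open>Both arguments are below pi/2 in absolute value, so their difference stays in the
  principal strip and no multiple of 2 pi i appears.\<close>

lemma Ln_quotient_right_half_plane:
  assumes "0 < Re w" "0 < Re z"
  shows "Ln (w / z) = Ln w - Ln z"
proof -
  have nz: "w \<noteq> 0" "z \<noteq> 0" using assms by auto
  have "\<bar>Im (Ln w)\<bar> < pi / 2" "\<bar>Im (Ln z)\<bar> < pi / 2"
    using Re_Ln_pos_lt[OF nz(1)] Re_Ln_pos_lt[OF nz(2)] assms by auto
  then have "Im (Ln w - Ln z) \<in> {-pi<..pi}" by auto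
  then have "Ln (exp (Ln w - Ln z)) = Ln w - Ln z" by (intro Ln_exp) auto
  then show ?thesis using nz by (simp add: exp_diff)
qed

text \<open>The sum telescopes up to second order: with \<open>v\<^sub>k = a q\<^sup>k\<close>, the quotient of
  \<open>1 + v\<^sub>k\<close> by \<open>1 + v\<^bsub>k+1\<^esub>\<close> is \<open>1 + (1/q - 1) v\<^bsub>k+1\<^esub> / (1 + v\<^bsub>k+1\<^esub>)\<close>.\<close>
lemma logarithmic_sum_tendsto:
  assumes a: "0 \<le> Re a"
  shows "((\<lambda>M. \<Sum>k. of_real (1 / base M - 1) * (a * of_real (base M ^ Suc k) / (1 + a * of_real (base M ^ Suc k))))
           \<longlongrightarrow> Ln (1 + a)) at_top"
proof -
  define X where "X = (\<lambda>M k. of_real (1 / base M - 1) * (a * of_real (base M ^ Suc k) / (1 + a * of_real (base M ^ Suc k))))"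
  have bnd: "eventually (\<lambda>M. \<forall>k. norm (X M k) \<le> (2 * norm a) / M * base M ^ k) at_top"
    using eventually_gt_at_top[of 0]
  proof eventually_elim
    case (elim M)
    note b = base_bounds[OF elim]
    show ?case
    proof
      fix k
      have "norm (X M k) = (1 / base M - 1) * (norm a * base M ^ Suc k / norm (1 + a * of_real (base M ^ Suc k)))"
        using b by (simp add: X_def norm_mult norm_divide norm_power del: of_real_power power_Suc of_real_diff of_real_divide)
      also have "\<dots> \<le> (1 / base M - 1) * (norm a * base M ^ Suc k / 1)"
        using b a Re_1_plus_ge(2)[OF a, of "base M ^ Suc k"]
        by (intro mult_left_mono divide_left_mono) auto
      also have "\<dots> = (1 - base M) * (norm a * base M ^ k)" using b by (simp add: field_simps)
      also have "\<dots> \<le> 2 / M * (norm a * base M ^ k)"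
        using exp_ge_add_one_self[of "- 2 / M"] by (intro mult_right_mono) (auto simp: base_def)
      finally show "norm (X M k) \<le> (2 * norm a) / M * base M ^ k" by (simp add: mult_ac)
    qed
  qed
  have quotient: "1 + (1 / q - 1) * (w / (1 + w)) = (1 + w / q) / (1 + w)"
    if "1 + w \<noteq> 0" "q \<noteq> 0" for w q :: complex
  proof -
    have "(1 / q - 1) * (w / (1 + w)) = (w / q - w) / (1 + w)"
      by (simp only: times_divide_eq_right left_diff_distrib) simp
    then have "1 + (1 / q - 1) * (w / (1 + w)) = 1 + (w / q - w) / (1 + w)" by simp
    also have "\<dots> = ((1 + w) + (w / q - w)) / (1 + w)"
      unfolding add_divide_distrib[of "1 + w"] using that(1) by simp
    finally show ?thesis by simp
  qed
  \<comment> \<open>The sum of logarithms equals \<open>Ln (1 + a)\<close> exactly for each positive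
    M; only replacing \<open>Ln (1 + X)\<close> by X needs M to grow.\<close>
  have tele: "\<forall>\<^sub>F M in at_top. (\<Sum>k. Ln (1 + X M k)) = Ln (1 + a)"
    using eventually_gt_at_top[of 0]
  proof eventually_elim
    case (elim M)
    note b = base_bounds[OF elim]
    have pos: "0 < Re (1 + a * of_real (base M ^ k))" for k
      using Re_1_plus_ge(1)[OF a, of "base M ^ k"] by simp
    have "Ln (1 + X M k) = Ln (1 + a * of_real (base M ^ k)) - Ln (1 + a * of_real (base M ^ Suc k))" for k
    proof -
      have nz: "1 + a * of_real (base M ^ Suc k) \<noteq> 0"
        using pos[of "Suc k"] by (metis less_irrefl zero_complex.sel(1))
      have "1 + X M k = (1 + a * of_real (base M ^ k)) / (1 + a * of_real (base M ^ Suc k))"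
        unfolding X_def using b
        quotient[OF nz, of "of_real (base M)"] by simp
      then show ?thesis by (simp only: Ln_quotient_right_half_plane[OF pos pos])
    qed
    moreover have "(\<lambda>k. Ln (1 + a * of_real (base M ^ k)) - Ln (1 + a * of_real (base M ^ Suc k))) sums
        (Ln (1 + a * of_real (base M ^ 0)) - Ln 1)"
    proof (rule telescope_sums')
      have "(\<lambda>k. 1 + a * complex_of_real (base M ^ k)) \<longlonglongrightarrow> 1 + a * of_real 0"
        using b by (intro tendsto_intros LIMSEQ_power_zero) auto
      then show "(\<lambda>k. Ln (1 + a * of_real (base M ^ k))) \<longlonglongrightarrow> Ln 1"
        by (intro tendsto_Ln) auto
    qed
    ultimately show ?case by (simp add: sums_iff)
  qed
  have "((\<lambda>M. (\<Sum>k. Ln (1 + X M k))) \<longlongrightarrow> Ln (1 + a)) at_top"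
    by (rule Lim_transform_eventually[OF tendsto_const]) (use tele in eventually_elim, simp)
  from tendsto_diff[OF this suminf_Ln_tendsto[OF bnd]] show ?thesis by (simp add: X_def)
qed

lemma qpoch_inf_nonzero:
  assumes "0 \<le> Re a" "M > 0"
  shows "qpoch_inf (- of_real (base M) * a) (of_real (base M)) \<noteq> 0"
proof -
  have "1 - (- of_real (base M) * a) * of_real (base M) ^ k \<noteq> (0::complex)" for k
  proof -
    have "1 - (- of_real (base M) * a) * of_real (base M) ^ k = 1 + a * of_real (base M ^ Suc k)"
      by (simp add: mult_ac)
    moreover have "1 \<le> norm (1 + a * of_real (base M ^ Suc k))"
      by (rule Re_1_plus_ge(2)[OF assms(1)]) simp
    ultimately show ?thesis by (metis norm_zero not_one_le_zero)
  qed
  then show ?thesis unfolding qpoch_inf_def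
    by (intro prodinf_nonzero qpoch_inf_convergent base_bounds assms)
qed

section \<open>Infinite products under a small relative change of the parameter\<close>

definition relative_shift :: "complex \<Rightarrow> complex \<Rightarrow> real \<Rightarrow> nat \<Rightarrow> complex" where
  "relative_shift a \<kappa> M k = (exp (\<kappa> / of_real M) - 1) *
     (a * of_real (base M ^ Suc k) / (1 + a * of_real (base M ^ Suc k)))"

text \<open>Multiplying a by exp(\<kappa>/M) changes the k-th factor by the relative amount
  \<open>relative_shift\<close>. Quotients of shifted by unshifted products, finite or infinite,
  thus become products of factors close to 1.\<close>

lemma relative_shift_factor:
  assumes "0 \<le> Re a"
  shows "1 - (- of_real (base M) * a * exp (\<kappa> / of_real M)) * of_real (base M) ^ k =
    (1 - (- of_real (base M) * a) * of_real (base M) ^ k) * (1 + relative_shift a \<kappa> M k)"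
proof -
  define w where "w = a * complex_of_real (base M ^ Suc k)"
  have nz: "1 + w \<noteq> 0"
    using Re_1_plus_ge(2)[OF assms, of "base M ^ Suc k"] by (auto simp: w_def)
  have "1 + w * exp (\<kappa> / of_real M) = (1 + w) * (1 + (exp (\<kappa> / of_real M) - 1) * (w / (1 + w)))"
  proof -
    have "(1 + w) * ((exp (\<kappa> / of_real M) - 1) * (w / (1 + w))) = (exp (\<kappa> / of_real M) - 1) * w"
      using nz by simp
    then show ?thesis by (simp add: distrib_left) (simp add: algebra_simps)
  qed
  then show ?thesis by (simp add: w_def relative_shift_def mult_ac)
qed

lemma exp_minus_one_tendsto:
  "((\<lambda>M. of_real M * (exp (\<kappa> / of_real M) - 1)) \<longlongrightarrow> (\<kappa>::complex)) at_top"
proof (cases "\<kappa> = 0")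
  case False
  have d: "((\<lambda>z::complex. (exp z - 1) / z) \<longlongrightarrow> 1) (at 0)"
    using DERIV_exp[of "0::complex"] by (simp add: has_field_derivative_iff)
  have "((\<lambda>M::real. \<kappa> / of_real M) \<longlongrightarrow> 0) at_top"
    by (intro tendsto_divide_0[OF tendsto_const] filterlim_of_real_at_infinity)
  moreover have "\<forall>\<^sub>F M::real in at_top. \<kappa> / of_real M \<noteq> 0"
    using eventually_gt_at_top[of 0] by eventually_elim (use False in auto)
  ultimately have "filterlim (\<lambda>M::real. \<kappa> / of_real M) (at 0) at_top"
    by (rule filterlim_atI)
  from filterlim_compose[OF d this]
  have "((\<lambda>M::real. \<kappa> * ((exp (\<kappa> / of_real M) - 1) / (\<kappa> / of_real M))) \<longlongrightarrow> \<kappa> * 1) at_top"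
    by (intro tendsto_intros)
  moreover have "\<kappa> * ((exp (\<kappa> / of_real M) - 1) / (\<kappa> / of_real M)) = of_real M * (exp (\<kappa> / of_real M) - 1)"
    for M :: real
    using False by simp
  ultimately show ?thesis by simp
qed auto

text \<open>Since M (exp(\<kappa>/M) - 1) tends to \<kappa>, its modulus is eventually below
  |\<kappa>| + 1, and the denominators have modulus at least 1. The same bound serves both the limit
  of the quotient and the domination of the finite products.\<close>

lemma relative_shift_bound:
  assumes "0 \<le> Re a"
  obtains C where "C \<ge> 0"
    "eventually (\<lambda>M. \<forall>k. norm (relative_shift a \<kappa> M k) \<le> C / M * base M ^ k) at_top"
proof -
  define C where "C = (norm \<kappa> + 1) * norm a"
  have "eventually (\<lambda>M. norm (of_real M * (exp (\<kappa> / of_real M) - 1)) < norm \<kappa> + 1) at_top"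
    using tendsto_norm[OF exp_minus_one_tendsto] by (rule order_tendstoD) simp
  with eventually_gt_at_top[of 0]
  have "eventually (\<lambda>M. \<forall>k. norm (relative_shift a \<kappa> M k) \<le> C / M * base M ^ k) at_top"
  proof eventually_elim
    case (elim M)
    note b = base_bounds[OF elim(1)]
    have 1: "norm (exp (\<kappa> / of_real M) - 1) \<le> (norm \<kappa> + 1) / M"
    proof -
      have "M * norm (exp (\<kappa> / of_real M) - 1) \<le> norm \<kappa> + 1"
        using elim by (simp add: norm_mult del: right_diff_distrib)
      then show ?thesis using elim(1) by (simp add: pos_le_divide_eq mult.commute)
    qed
    show ?case
    proof
      fix k
      have "norm (relative_shift a \<kappa> M k) = norm (exp (\<kappa> / of_real M) - 1) *
          (norm a * base M ^ Suc k / norm (1 + a * of_real (base M ^ Suc k)))"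
        by (simp add: relative_shift_def norm_mult norm_divide norm_power del: of_real_power power_Suc)
      also have "\<dots> \<le> (norm \<kappa> + 1) / M * (norm a * base M ^ k / 1)"
        using b elim Re_1_plus_ge(2)[OF assms, of "base M ^ Suc k"]
        by (intro mult_mono frac_le 1 mult_left_mono) auto
      finally show "norm (relative_shift a \<kappa> M k) \<le> C / M * base M ^ k" by (simp add: mult_ac C_def)
    qed
  qed
  then show ?thesis by (intro that[of C]) (simp_all add: C_def)
qed

text \<open>The perturbations are those of the telescoping sum for \<open>Ln (1 + a)\<close>, with
  weight exp(\<kappa>/M) - 1 in place of 1/q - 1. The first weight behaves like \<kappa>/M, the
  second like 2/M, and their ratio gives \<kappa>/2.\<close>

lemma qpoch_inf_shift_tendsto:
  assumes a: "0 \<le> Re a"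
  shows "((\<lambda>M. qpoch_inf (- of_real (base M) * a * exp (\<kappa> / of_real M)) (of_real (base M)) /
      qpoch_inf (- of_real (base M) * a) (of_real (base M))) \<longlongrightarrow> exp (\<kappa> / 2 * Ln (1 + a))) at_top"
proof -
  obtain C where bnd: "eventually (\<lambda>M. \<forall>k. norm (relative_shift a \<kappa> M k) \<le> C / M * base M ^ k) at_top"
    using relative_shift_bound[OF a] by blast
  define S where "S = (\<lambda>M k. of_real (1 / base M - 1) * (a * of_real (base M ^ Suc k) / (1 + a * of_real (base M ^ Suc k))))"
  have "((\<lambda>M. (of_real M * (exp (\<kappa> / of_real M) - 1)) * of_real (1 / (M * (1 / base M - 1))) * (\<Sum>k. S M k))
      \<longlongrightarrow> \<kappa> * of_real (1 / 2) * Ln (1 + a)) at_top"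
    unfolding S_def base_def
    by (intro tendsto_mult exp_minus_one_tendsto tendsto_of_real logarithmic_sum_tendsto[OF a, unfolded base_def]) real_asymp
  moreover have "\<forall>\<^sub>F M in at_top. (of_real M * (exp (\<kappa> / of_real M) - 1)) * of_real (1 / (M * (1 / base M - 1))) * (\<Sum>k. S M k)
      = (\<Sum>k. relative_shift a \<kappa> M k)"
    using eventually_gt_at_top[of 0]
  proof eventually_elim
    case (elim M)
    define c where "c = (of_real M * (exp (\<kappa> / of_real M) - 1)) * of_real (1 / (M * (1 / base M - 1)))"
    note b = base_bounds[OF elim]
    have "summable (\<lambda>k. norm (a * of_real (base M ^ Suc k) / (1 + a * of_real (base M ^ Suc k))))"
    proof (rule summable_geometric_bound)
      show "norm (a * of_real (base M ^ Suc k) / (1 + a * of_real (base M ^ Suc k))) \<le> norm a * base M ^ k" for k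
      proof -
        have "norm (a * of_real (base M ^ Suc k)) \<le> norm a * base M ^ k"
          unfolding norm_mult using b by (intro mult_left_mono) (auto simp: norm_mult norm_power mult_left_le_one_le)
        moreover have "1 \<le> norm (1 + a * of_real (base M ^ Suc k))"
          by (rule Re_1_plus_ge(2)[OF a]) simp
        ultimately show ?thesis
          using frac_le[of "norm a * base M ^ k" "norm (a * of_real (base M ^ Suc k))" 1]
          by (simp add: norm_divide del: power_Suc of_real_power)
      qed
    qed (use b in auto)
    then have s: "summable (S M)" unfolding S_def by (intro summable_mult) (rule summable_norm_cancel)
    have nz: "1 / base M - 1 \<noteq> 0" using b by simp
    have "c * S M k = relative_shift a \<kappa> M k" for k
    proof -
      have "c * of_real (1 / base M - 1) = exp (\<kappa> / of_real M) - 1"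
      proof -
        have "c * of_real (1 / base M - 1) =
            (exp (\<kappa> / of_real M) - 1) * of_real (M * (1 / (M * (1 / base M - 1))) * (1 / base M - 1))"
          unfolding c_def of_real_mult by (simp only: mult_ac)
        also have "M * (1 / (M * (1 / base M - 1))) * (1 / base M - 1) = 1"
          using nz elim nonzero_divide_mult_cancel_left[of M] by simp
        finally show ?thesis by simp
      qed
      then show ?thesis by (simp add: S_def relative_shift_def mult.assoc[symmetric])
    qed
    moreover have "c * (\<Sum>k. S M k) = (\<Sum>k. c * S M k)" by (rule suminf_mult[OF s, symmetric])
    ultimately show ?case by (simp add: c_def)
  qed
  ultimately have "((\<lambda>M. \<Sum>k. relative_shift a \<kappa> M k) \<longlongrightarrow> \<kappa> * of_real (1 / 2) * Ln (1 + a)) at_top"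
    by (rule Lim_transform_eventually)
  from prodinf_tendsto_exp[OF bnd this]
  have lim: "((\<lambda>M. \<Prod>k. 1 + relative_shift a \<kappa> M k) \<longlongrightarrow> exp (\<kappa> / 2 * Ln (1 + a))) at_top" by simp
  have "\<forall>\<^sub>F M in at_top. (\<Prod>k. 1 + relative_shift a \<kappa> M k) =
     qpoch_inf (- of_real (base M) * a * exp (\<kappa> / of_real M)) (of_real (base M)) /
      qpoch_inf (- of_real (base M) * a) (of_real (base M))"
    using eventually_gt_at_top[of 0] bnd
  proof eventually_elim
    case (elim M)
    note b = base_bounds[OF elim(1)]
    have "summable (\<lambda>k. norm (relative_shift a \<kappa> M k))"
      using elim b by (intro summable_geometric_bound[of _ "C / M" "base M"]) auto
    then have c: "convergent_prod (\<lambda>k. 1 + relative_shift a \<kappa> M k)"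
      by (intro abs_convergent_prod_imp_convergent_prod summable_imp_abs_convergent_prod) simp
    have "qpoch_inf (- of_real (base M) * a * exp (\<kappa> / of_real M)) (of_real (base M)) =
        qpoch_inf (- of_real (base M) * a) (of_real (base M)) * (\<Prod>k. 1 + relative_shift a \<kappa> M k)"
      unfolding qpoch_inf_def relative_shift_factor[OF a]
      by (rule prodinf_mult[symmetric, OF qpoch_inf_convergent c]) (use b in auto)
    then show ?case using qpoch_inf_nonzero[OF a elim(1)] by simp
  qed
  with lim show ?thesis by (rule Lim_transform_eventually)
qed

section \<open>An explicit formula for the Al-Salam--Chihara polynomials\<close>

text \<open>The generating function of \<open>Q\<^sub>n/(q;q)\<^sub>n\<close> is a product of two \<open>q\<close>-binomial series; it is identified
  through the \<open>q\<close>-difference equation that each factor satisfies.\<close>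

definition qbinomial_fps :: "complex \<Rightarrow> complex \<Rightarrow> complex \<Rightarrow> complex fps" where
  "qbinomial_fps q c w = Abs_fps (\<lambda>n. qpoch (c / w) q n / qpoch q q n * w ^ n)"

text \<open>The series F(qX). This substitution is multiplicative, so the functional equations of
  two factors combine into one for their product.\<close>

definition fps_dilate :: "complex \<Rightarrow> complex fps \<Rightarrow> complex fps" where
  "fps_dilate q F = Abs_fps (\<lambda>n. q ^ n * F $ n)"

lemma fps_dilate_mult: "fps_dilate q (F * G) = fps_dilate q F * fps_dilate q G"
proof (rule fps_ext)
  fix n
  have "q ^ n * (\<Sum>i=0..n. F $ i * G $ (n - i)) = (\<Sum>i=0..n. (q ^ i * F $ i) * (q ^ (n - i) * G $ (n - i)))"
    unfolding sum_distrib_left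
  proof (rule sum.cong)
    fix i assume "i \<in> {0..n}"
    then have "q ^ n = q ^ i * q ^ (n - i)" by (simp flip: power_add)
    then show "q ^ n * (F $ i * G $ (n - i)) = (q ^ i * F $ i) * (q ^ (n - i) * G $ (n - i))" by simp
  qed simp
  then show "fps_dilate q (F * G) $ n = (fps_dilate q F * fps_dilate q G) $ n"
    by (simp add: fps_dilate_def fps_mult_nth)
qed

lemma fps_nth_linear_mult_Suc:
  "((1 - fps_const c * fps_X) * F) $ Suc n = F $ Suc n - c * F $ n" for F :: "complex fps"
  by (simp add: left_diff_distrib mult.assoc)

lemma fps_nth_linear_mult_0: "((1 - fps_const c * fps_X) * F) $ 0 = F $ 0" for F :: "complex fps"
  by (simp add: left_diff_distrib mult.assoc)

lemma qpoch_Suc: "qpoch a q (Suc n) = qpoch a q n * (1 - a * q ^ n)"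
  by (simp add: qpoch_def)

lemma qpoch_0 [simp]: "qpoch a q 0 = 1"
  by (simp add: qpoch_def)

lemma qpoch_self_nonzero:
  assumes "\<And>n. q ^ Suc n \<noteq> 1"
  shows "qpoch q q n \<noteq> 0"
  using assms by (auto simp: qpoch_def)

text \<open>Coefficientwise this is the two-term recurrence (1 - q^(k+1)) F_(k+1) = (w - c q^k) F_k.
  It is the one-step form of the q-binomial theorem and avoids both the infinite product and any
  question of convergence.\<close>

lemma qbinomial_fps_functional_equation:
  assumes q: "\<And>n. q ^ Suc n \<noteq> 1" and "w \<noteq> 0"
  shows "(1 - fps_const w * fps_X) * qbinomial_fps q c w = (1 - fps_const c * fps_X) * fps_dilate q (qbinomial_fps q c w)"
proof (rule fps_ext)
  fix n
  define F where "F = qbinomial_fps q c w"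
  show "((1 - fps_const w * fps_X) * F) $ n = ((1 - fps_const c * fps_X) * fps_dilate q F) $ n"
  proof (cases n)
    case 0
    then show ?thesis by (simp only: fps_nth_linear_mult_0) (simp add: fps_dilate_def)
  next
    case (Suc k)
    have "1 - q * q ^ k \<noteq> 0" using q[of k] by simp
    then have "(1 - q * q ^ k) * F $ Suc k = (1 - c / w * q ^ k) * w * F $ k"
      by (simp add: F_def qbinomial_fps_def qpoch_Suc)
    also have "\<dots> = (w - c * q ^ k) * F $ k" using assms(2) by (simp add: left_diff_distrib)
    finally show ?thesis
      unfolding Suc fps_nth_linear_mult_Suc by (simp add: fps_dilate_def algebra_simps)
  qed
qed

text \<open>As (1 - wX)(1 - X/w) = 1 - 2xX + X^2 with 2x = w + 1/w, and the other side has the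
  factor 1 - (a+b)X + abX^2, comparing coefficients gives a three-term recurrence for the
  coefficients of S. Multiplied by (q;q)_(n+1), it becomes the recurrence of the
  polynomials.\<close>

lemma al_salam_chihara_explicit:
  assumes q: "\<And>n. q ^ Suc n \<noteq> 1" and w: "w \<noteq> 0"
  shows "al_salam_chihara n ((w + 1 / w) / 2) a b q / qpoch q q n =
    (\<Sum>j\<le>n. (qpoch (a / w) q j / qpoch q q j * w ^ j) *
            (qpoch (b * w) q (n - j) / qpoch q q (n - j) * (1 / w) ^ (n - j)))"
proof -
  define S where "S = qbinomial_fps q a w * qbinomial_fps q b (1 / w)"
  have "(1 - fps_const w * fps_X) * ((1 - fps_const (1 / w) * fps_X) * S) =
      ((1 - fps_const w * fps_X) * qbinomial_fps q a w) *
      ((1 - fps_const (1 / w) * fps_X) * qbinomial_fps q b (1 / w))"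
    by (simp add: S_def mult_ac)
  also have "\<dots> = ((1 - fps_const a * fps_X) * fps_dilate q (qbinomial_fps q a w)) *
      ((1 - fps_const b * fps_X) * fps_dilate q (qbinomial_fps q b (1 / w)))"
    by (simp only: qbinomial_fps_functional_equation[OF q] w divide_eq_0_iff one_neq_zero simp_thms)
  also have "\<dots> = (1 - fps_const a * fps_X) * ((1 - fps_const b * fps_X) * fps_dilate q S)"
    by (simp add: S_def fps_dilate_mult mult_ac)
  finally have eq: "(1 - fps_const w * fps_X) * ((1 - fps_const (1 / w) * fps_X) * S) = \<dots>" .
  have S0: "S $ 0 = 1" by (simp add: S_def qbinomial_fps_def)
  \<comment> \<open>The first coefficient is treated apart: it matches the separate clause for
    degree one.\<close>
  have rec0: "(1 - q) * S $ Suc 0 = w + 1 / w - (a + b)"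
    using arg_cong[OF eq, of "\<lambda>F. F $ Suc 0"]
    unfolding fps_nth_linear_mult_Suc fps_nth_linear_mult_0
    by (simp add: fps_dilate_def S0 algebra_simps)
  have rec: "(1 - q ^ Suc (Suc n)) * S $ Suc (Suc n) =
      (w + 1 / w - (a + b) * q ^ Suc n) * S $ Suc n - (1 - a * b * q ^ n) * S $ n" for n
    using arg_cong[OF eq, of "\<lambda>F. F $ Suc (Suc n)"] w
    unfolding fps_nth_linear_mult_Suc
    by (simp add: fps_dilate_def algebra_simps)
  define x where "x = (w + 1 / w) / 2"
  have x: "2 * x = w + 1 / w" by (simp add: x_def)
  \<comment> \<open>Two consecutive degrees are carried along because the recurrence reaches back
    two steps.\<close>
  have "al_salam_chihara n x a b q = qpoch q q n * S $ n
      \<and> al_salam_chihara (Suc n) x a b q = qpoch q q (Suc n) * S $ Suc n"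
  proof (induction n)
    case 0
    show ?case using rec0 x by (simp add: S0 qpoch_Suc)
  next
    case (Suc n)
    define P where "P = qpoch q q n"
    have "al_salam_chihara (Suc (Suc n)) x a b q =
        (w + 1 / w - (a + b) * q ^ Suc n) * (qpoch q q (Suc n) * S $ Suc n)
        - (1 - q ^ Suc n) * (1 - a * b * q ^ n) * (qpoch q q n * S $ n)"
      using Suc x by simp
    also have "\<dots> = qpoch q q (Suc n) * ((w + 1 / w - (a + b) * q ^ Suc n) * S $ Suc n
        - (1 - a * b * q ^ n) * S $ n)"
      by (simp add: qpoch_Suc flip: P_def) (simp add: algebra_simps)
    also have "\<dots> = qpoch q q (Suc n) * ((1 - q ^ Suc (Suc n)) * S $ Suc (Suc n))"
      by (simp only: rec)
    also have "\<dots> = qpoch q q (Suc (Suc n)) * S $ Suc (Suc n)"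
      by (simp add: qpoch_Suc)
    finally show ?case using Suc by blast
  qed
  then have "al_salam_chihara n x a b q / qpoch q q n = S $ n"
    using qpoch_self_nonzero[OF q] by simp
  then show ?thesis
    by (simp add: x_def S_def fps_mult_nth qbinomial_fps_def atMost_atLeast0)
qed

section \<open>Asymptotics of the summands\<close>

text \<open>One half of a normalised summand. The last factor is (q;q)_inf/(q;q)_j: each half takes
  one of the two factors (q;q)_inf of the prefactor and the infinite product of its own parameter.
  The values \<kappa> = -iu and \<kappa> = iu encode the parameters a/w and bw of the explicit
  formula at w = exp(iu/M).\<close>

definition kernel_factor :: "complex \<Rightarrow> complex \<Rightarrow> real \<Rightarrow> nat \<Rightarrow> complex" where
  "kernel_factor a \<kappa> M j =
     qpoch (- of_real (base M) * a * exp (\<kappa> / of_real M)) (of_real (base M)) j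
     / qpoch_inf (- of_real (base M) * a) (of_real (base M))
     * qpoch_inf (of_real (base M ^ Suc j)) (of_real (base M))"

lemma normalized_polynomial_eq_sum:
  assumes M: "M > 0"
  defines "q \<equiv> complex_of_real (base M)"
  shows "(qpoch_inf q q)\<^sup>2 / (of_real M * qpoch_inf (- q * a) q * qpoch_inf (- q * b) q)
      * (al_salam_chihara n (of_real (cos (u / M))) (- q * a) (- q * b) q / qpoch q q n) =
    (\<Sum>j\<le>n. kernel_factor a (- \<i> * of_real u) M j * kernel_factor b (\<i> * of_real u) M (n - j)
       * exp (\<i> * of_real (u * (2 * real j - real n) / M))) / of_real M"
proof -
  note b = base_bounds[OF M]
  define w where "w = exp (\<i> * of_real (u / M))"
  have w: "w \<noteq> 0" by (simp add: w_def)
  have winv: "1 / w = exp (- \<i> * of_real u / of_real M)"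
    by (simp add: w_def exp_minus inverse_eq_divide)
  have weq: "w = exp (\<i> * of_real u / of_real M)" by (simp add: w_def)
  have qn: "q ^ Suc n \<noteq> 1" for n
  proof
    assume "q ^ Suc n = 1"
    then have "norm q ^ Suc n = 1" by (metis norm_one norm_power)
    moreover have "norm q ^ Suc n < 1" using b by (intro power_Suc_less_one) (auto simp: q_def)
    ultimately show False by simp
  qed
  have cos: "of_real (cos (u / M)) = (w + 1 / w) / 2"
    by (simp add: w_def cos_exp_eq exp_minus inverse_eq_divide flip: cos_of_real)
  have split: "qpoch_inf q q / qpoch q q j = qpoch_inf (of_real (base M ^ Suc j)) q" for j
    using qpoch_inf_split[OF b(3), of q j] qpoch_self_nonzero[OF qn, of j] by (simp add: q_def)
  have phase: "w ^ j * (1 / w) ^ (n - j) = exp (\<i> * of_real (u * (2 * real j - real n) / M))"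
    if "j \<le> n" for j
  proof -
    have "w ^ j * (1 / w) ^ (n - j) = exp (of_nat j * (\<i> * of_real u / of_real M) + of_nat (n - j) * (- \<i> * of_real u / of_real M))"
      unfolding winv unfolding weq by (simp only: exp_add exp_of_nat_mult)
    also have "of_nat j * (\<i> * of_real u / of_real M) + of_nat (n - j) * (- \<i> * of_real u / of_real M)
       = \<i> * of_real (u * (2 * real j - real n) / M)"
      using that M by (simp add: of_nat_diff field_simps)
    finally show ?thesis .
  qed
  have "(qpoch_inf q q)\<^sup>2 / (of_real M * A * B) *
        ((qpoch (- q * a / w) q j / qpoch q q j * w ^ j) *
            (qpoch (- q * b * w) q (n - j) / qpoch q q (n - j) * (1 / w) ^ (n - j))) =
      (qpoch (- q * a / w) q j / A * (qpoch_inf q q / qpoch q q j)) *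
      (qpoch (- q * b * w) q (n - j) / B * (qpoch_inf q q / qpoch q q (n - j))) *
      (w ^ j * (1 / w) ^ (n - j)) / of_real M" for A B j
    by (simp add: power2_eq_square mult_ac)
  also have "(qpoch (- q * a / w) q j / qpoch_inf (- q * a) q * (qpoch_inf q q / qpoch q q j)) *
      (qpoch (- q * b * w) q (n - j) / qpoch_inf (- q * b) q * (qpoch_inf q q / qpoch q q (n - j))) *
      (w ^ j * (1 / w) ^ (n - j)) / of_real M =
     kernel_factor a (- \<i> * of_real u) M j * kernel_factor b (\<i> * of_real u) M (n - j)
       * exp (\<i> * of_real (u * (2 * real j - real n) / M)) / of_real M" if "j \<le> n" for j
    unfolding kernel_factor_def split phase[OF that] winv[symmetric] weq[symmetric] q_def[symmetric] by simp
  finally show ?thesis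
    unfolding cos al_salam_chihara_explicit[OF qn w] sum_distrib_left sum_divide_distrib
    by (intro sum.cong) auto
qed

text \<open>Writing the finite symbol as a quotient of infinite ones leaves three limits: the
  relative shift gives the power of 1 + a, the removed tail has parameter about -ac/M and
  contributes exp(-ac/2), and the last product contributes exp(-c/2).\<close>

lemma kernel_factor_tendsto:
  assumes a: "0 \<le> Re a" and j: "((\<lambda>M. M * base M ^ j M) \<longlongrightarrow> c) at_top"
  shows "((\<lambda>M. kernel_factor a \<kappa> M (j M)) \<longlongrightarrow> exp (\<kappa> / 2 * Ln (1 + a) - (1 + a) * of_real c / 2)) at_top"
proof -
  define z where "z = (\<lambda>M. - of_real (base M) * a * exp (\<kappa> / of_real M))"
  have base1: "(base \<longlongrightarrow> 1) at_top" unfolding base_def by real_asymp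
  have e1: "((\<lambda>M. exp (\<kappa> / of_real M)) \<longlongrightarrow> exp 0) at_top"
    by (intro tendsto_exp tendsto_divide_0[OF tendsto_const] filterlim_of_real_at_infinity)
  have jc: "((\<lambda>M. complex_of_real (M * base M ^ j M)) \<longlongrightarrow> of_real c) at_top"
    using j by (rule tendsto_of_real)
  have "((\<lambda>M. - of_real (base M) * a * exp (\<kappa> / of_real M) * of_real (M * base M ^ j M)) \<longlongrightarrow> - of_real 1 * a * exp 0 * of_real c) at_top"
    by (intro tendsto_mult tendsto_minus tendsto_of_real[OF base1] tendsto_const e1 jc)
  then have "((\<lambda>M. of_real M * (z M * of_real (base M) ^ j M)) \<longlongrightarrow> - a * of_real c) at_top"
    by (simp add: z_def mult_ac)
  from qpoch_inf_tendsto[OF this]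
  have 1: "((\<lambda>M. qpoch_inf (z M * of_real (base M) ^ j M) (of_real (base M))) \<longlongrightarrow> exp (a * of_real c / 2)) at_top"
    by simp
  have "((\<lambda>M. of_real (base M) * of_real (M * base M ^ j M)) \<longlongrightarrow> of_real 1 * complex_of_real c) at_top"
    by (intro tendsto_mult tendsto_of_real[OF base1] jc)
  then have "((\<lambda>M. of_real M * of_real (base M ^ Suc (j M))) \<longlongrightarrow> complex_of_real c) at_top"
    by (simp add: mult_ac)
  note 2 = qpoch_inf_tendsto[OF this]
  have nz: "exp (a * of_real c / 2) \<noteq> 0" by simp
  have "((\<lambda>M. qpoch_inf (z M) (of_real (base M)) / qpoch_inf (- of_real (base M) * a) (of_real (base M))
      / qpoch_inf (z M * of_real (base M) ^ j M) (of_real (base M))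
      * qpoch_inf (of_real (base M ^ Suc (j M))) (of_real (base M))) \<longlongrightarrow>
     exp (\<kappa> / 2 * Ln (1 + a)) / exp (a * of_real c / 2) * exp (- of_real c / 2)) at_top"
    unfolding z_def using qpoch_inf_shift_tendsto[OF a] 1 2 nz unfolding z_def
    by (intro tendsto_mult tendsto_divide)
  \<comment> \<open>The removed tail is a denominator here. Its limit is an exponential, so it is
    nonzero for large M.\<close>
  moreover have "\<forall>\<^sub>F M in at_top. qpoch_inf (z M) (of_real (base M)) / qpoch_inf (- of_real (base M) * a) (of_real (base M))
      / qpoch_inf (z M * of_real (base M) ^ j M) (of_real (base M))
      * qpoch_inf (of_real (base M ^ Suc (j M))) (of_real (base M)) = kernel_factor a \<kappa> M (j M)"
    using tendsto_imp_eventually_ne[OF 1 nz] eventually_gt_at_top[of 0]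
  proof eventually_elim
    case (elim M)
    then show ?case
      using qpoch_inf_split[OF base_bounds(3)[OF elim(2)], of "z M" "j M"]
      by (simp add: kernel_factor_def z_def)
  qed
  ultimately have "((\<lambda>M. kernel_factor a \<kappa> M (j M)) \<longlongrightarrow>
     exp (\<kappa> / 2 * Ln (1 + a)) / exp (a * of_real c / 2) * exp (- of_real c / 2)) at_top"
    by (rule Lim_transform_eventually)
  also have "exp (\<kappa> / 2 * Ln (1 + a)) / exp (a * of_real c / 2) * exp (- of_real c / 2) =
     exp (\<kappa> / 2 * Ln (1 + a) - (1 + a) * of_real c / 2)"
    by (simp add: exp_diff[symmetric] exp_add[symmetric] algebra_simps add_divide_distrib)
  finally show ?thesis .
qed

section \<open>Bounds uniform in the summation index\<close>

lemma norm_qpoch_inf_le_exp: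
  assumes q: "0 < q" "q < 1" and t: "0 \<le> t" "t \<le> 1"
  shows "norm (qpoch_inf (of_real t) (of_real q)) \<le> exp (- t / (1 - q))"
proof (rule LIMSEQ_le)
  have nq: "norm (complex_of_real q) < 1" using q by simp
  show "(\<lambda>n. norm (qpoch (of_real t) (of_real q) n)) \<longlonglongrightarrow> norm (qpoch_inf (of_real t) (of_real q))"
    by (intro tendsto_norm qpoch_LIMSEQ nq)
  have "(\<lambda>n. \<Sum>k<n. q ^ k) \<longlonglongrightarrow> 1 / (1 - q)"
    using geometric_sums[of q] q by (simp add: sums_def)
  then have "(\<lambda>n. exp (- t * (\<Sum>k<n. q ^ k))) \<longlonglongrightarrow> exp (- t * (1 / (1 - q)))"
    by (intro tendsto_intros)
  then show "(\<lambda>n. exp (- t * (\<Sum>k<n. q ^ k))) \<longlonglongrightarrow> exp (- t / (1 - q))" by simp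
  have "norm (qpoch (of_real t) (of_real q) n) \<le> exp (- t * (\<Sum>k<n. q ^ k))" for n
  proof -
    have "norm (qpoch (of_real t) (of_real q) n) = (\<Prod>k<n. norm (1 - complex_of_real t * of_real q ^ k))"
      by (simp add: qpoch_def prod_norm)
    also have "\<dots> \<le> (\<Prod>k<n. exp (- t * q ^ k))"
    proof (rule prod_mono, intro conjI)
      fix k
      \<comment> \<open>Each factor is a nonnegative real, so its modulus is the factor itself and 1
        - s <= exp(-s) applies.\<close>
      have "t * q ^ k \<le> 1" using q t by (intro mult_le_one power_le_one) auto
      moreover have "1 - complex_of_real t * of_real q ^ k = of_real (1 - t * q ^ k)" by simp
      ultimately have "norm (1 - complex_of_real t * of_real q ^ k) = 1 - t * q ^ k"
        by (simp only: norm_of_real)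
      then show "norm (1 - complex_of_real t * of_real q ^ k) \<le> exp (- t * q ^ k)"
        using exp_ge_add_one_self[of "- t * q ^ k"] by simp
    qed simp
    also have "\<dots> = exp (- t * (\<Sum>k<n. q ^ k))"
      by (simp add: exp_sum sum_distrib_left)
    finally show ?thesis .
  qed
  then show "\<exists>N. \<forall>n\<ge>N. norm (qpoch (of_real t) (of_real q) n) \<le> exp (- t * (\<Sum>k<n. q ^ k))" by blast
qed

lemma norm_qpoch_inf_ge_1:
  assumes a: "0 \<le> Re a" and q: "0 < q" "q < 1"
  shows "1 \<le> norm (qpoch_inf (- a) (of_real q))"
proof (rule LIMSEQ_le_const)
  show "(\<lambda>n. norm (qpoch (- a) (of_real q) n)) \<longlonglongrightarrow> norm (qpoch_inf (- a) (of_real q))"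
    using q by (intro tendsto_norm qpoch_LIMSEQ) simp
  have "1 \<le> norm (qpoch (- a) (of_real q) n)" for n
    unfolding qpoch_def prod_norm[symmetric]
    using Re_1_plus_ge(2)[OF a] q by (intro prod_ge_1) (simp flip: of_real_power)
  then show "\<exists>N. \<forall>n\<ge>N. 1 \<le> norm (qpoch (- a) (of_real q) n)" by blast
qed

text \<open>After cancelling the common finite symbol, the numerator is a finite product of relative
  shifts, at most exp(C), over a tail of modulus at least 1. All decay comes from (q^(j+1);q)_inf,
  where 1 - q <= 2/M produces the rate M/2. Uniformity in j is what allows domination over the whole
  line.\<close>

lemma kernel_factor_bound:
  assumes a: "0 \<le> Re a"
  obtains C where "C > 0"
    "eventually (\<lambda>M. \<forall>j. norm (kernel_factor a \<kappa> M j) \<le> C * exp (- (M / 2) * base M ^ Suc j)) at_top"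
proof -
  obtain C where C: "C \<ge> 0" and
    bnd: "eventually (\<lambda>M. \<forall>k. norm (relative_shift a \<kappa> M k) \<le> C / M * base M ^ k) at_top"
    using relative_shift_bound[OF a] by blast
  \<comment> \<open>The quantity tends to 2; the weaker bound 1 suffices to keep the geometric
    series 1/(1 - q) below M.\<close>
  have "eventually (\<lambda>M. 1 \<le> M * (1 - base M)) at_top"
    unfolding base_def by real_asymp
  with bnd eventually_gt_at_top[of 0]
  have "eventually (\<lambda>M. \<forall>j. norm (kernel_factor a \<kappa> M j) \<le> exp C * exp (- (M / 2) * base M ^ Suc j)) at_top"
  proof eventually_elim
    case (elim M)
    define q where "q = complex_of_real (base M)"
    note b = base_bounds[OF elim(2)]
    show ?case
    proof
      fix j
      define D where "D = qpoch (- q * a) q j"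
      have sp: "qpoch_inf (- q * a) q = D * qpoch_inf (- (a * of_real (base M ^ Suc j))) q"
        using qpoch_inf_split[OF b(3), of "- q * a" j] by (simp add: D_def q_def mult_ac)
      have nz: "qpoch_inf (- q * a) q \<noteq> 0"
        using qpoch_inf_nonzero[OF a elim(2)] by (simp add: q_def)
      have ge1: "1 \<le> norm (qpoch_inf (- (a * of_real (base M ^ Suc j))) q)"
        unfolding q_def using a b by (intro norm_qpoch_inf_ge_1) auto
      have fin: "qpoch (- q * a * exp (\<kappa> / of_real M)) q j = D * (\<Prod>k<j. 1 + relative_shift a \<kappa> M k)"
        unfolding D_def qpoch_def q_def relative_shift_factor[OF a] by (rule prod.distrib)
      have "norm (\<Prod>k<j. 1 + relative_shift a \<kappa> M k) \<le> (\<Prod>k<j. exp (C / M * base M ^ k))"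
        unfolding prod_norm[symmetric]
      proof (rule prod_mono, intro conjI)
        fix k
        have "norm (1 + relative_shift a \<kappa> M k) \<le> 1 + norm (relative_shift a \<kappa> M k)"
          using norm_triangle_ineq[of 1 "relative_shift a \<kappa> M k"] by simp
        also have "\<dots> \<le> 1 + C / M * base M ^ k" using elim(1) by simp
        also have "\<dots> \<le> exp (C / M * base M ^ k)" by (rule exp_ge_add_one_self)
        finally show "norm (1 + relative_shift a \<kappa> M k) \<le> exp (C / M * base M ^ k)" .
      qed simp
      also have "\<dots> = exp (C / M * (\<Sum>k<j. base M ^ k))"
        by (simp add: exp_sum sum_distrib_left)
      also have "\<dots> \<le> exp C"
      proof -
        have "(\<Sum>k<j. base M ^ k) \<le> (\<Sum>k. base M ^ k)"
          using b by (intro sum_le_suminf summable_geometric) auto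
        also have "\<dots> = 1 / (1 - base M)" using b by (simp add: suminf_geometric)
        also have "\<dots> \<le> M" using elim(3) b by (simp add: divide_le_eq)
        finally have "C / M * (\<Sum>k<j. base M ^ k) \<le> C / M * M"
          using C elim(2) by (intro mult_left_mono) auto
        then show ?thesis using elim(2) by simp
      qed
      finally have P: "norm (\<Prod>k<j. 1 + relative_shift a \<kappa> M k) \<le> exp C" .
      have "qpoch (- q * a * exp (\<kappa> / of_real M)) q j / qpoch_inf (- q * a) q =
          (\<Prod>k<j. 1 + relative_shift a \<kappa> M k) / qpoch_inf (- (a * of_real (base M ^ Suc j))) q"
        using nz unfolding sp fin by simp
      then have 1: "norm (qpoch (- q * a * exp (\<kappa> / of_real M)) q j / qpoch_inf (- q * a) q) \<le> exp C"
        using frac_le[OF _ P _ ge1] by (simp add: norm_divide)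
      have "norm (qpoch_inf (of_real (base M ^ Suc j)) q) \<le> exp (- (base M ^ Suc j) / (1 - base M))"
        unfolding q_def using b by (intro norm_qpoch_inf_le_exp power_le_one) auto
      also have "\<dots> \<le> exp (- (M / 2) * base M ^ Suc j)"
      proof -
        have "1 - base M \<le> 2 / M"
          using exp_ge_add_one_self[of "- 2 / M"] by (simp add: base_def)
        then have "M / 2 \<le> 1 / (1 - base M)" using b elim(2) by (simp add: field_simps)
        then have "M / 2 * base M ^ Suc j \<le> 1 / (1 - base M) * base M ^ Suc j"
          by (intro mult_right_mono) auto
        then show ?thesis by simp
      qed
      finally have 2: "norm (qpoch_inf (of_real (base M ^ Suc j)) q) \<le> exp (- (M / 2) * base M ^ Suc j)" .
      show "norm (kernel_factor a \<kappa> M j) \<le> exp C * exp (- (M / 2) * base M ^ Suc j)"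
        unfolding kernel_factor_def norm_mult q_def[symmetric]
        by (intro mult_mono 1[unfolded norm_mult] 2) auto
    qed
  qed
  then show ?thesis by (intro that[of "exp C"]) simp_all
qed

section \<open>The Macdonald function and the contour shift\<close>

definition bessel_kernel :: "real \<Rightarrow> real \<Rightarrow> complex \<Rightarrow> complex" where
  "bessel_kernel u z w = exp (\<i> * of_real u * w - of_real z * cosh w)"

lemma Re_cosh_complex: "Re (cosh w) = cosh (Re w) * cos (Im w)"
  by (simp add: cosh_def Re_exp algebra_simps)

text \<open>The decay rate on a horizontal line is z cos(Im w). It is positive for |Im w| < pi/2,
  the strip in which the line of integration may move.\<close>

lemma norm_bessel_kernel:
  "norm (bessel_kernel u z w) = exp (- u * Im w - z * (cosh (Re w) * cos (Im w)))"
  by (simp add: bessel_kernel_def norm_exp_eq_Re Re_cosh_complex)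

text \<open>For nonnegative arguments, average the quadratic lower bound for exp(x) and the linear
  one for exp(-x); evenness covers the rest.\<close>

lemma cosh_ge_1_plus_square: "1 + y\<^sup>2 / 4 \<le> cosh (y :: real)"
proof -
  have pos: "1 + x\<^sup>2 / 4 \<le> cosh x" if "0 \<le> x" for x :: real
  proof -
    have "1 + x + x\<^sup>2 / 2 \<le> exp x" using exp_lower_Taylor_quadratic[OF that] .
    moreover have "1 - x \<le> exp (- x)" using exp_ge_add_one_self[of "- x"] by simp
    ultimately show ?thesis by (simp add: cosh_def scaleR_conv_of_real field_simps)
  qed
  show ?thesis using pos[of y] pos[of "- y"] by (cases "0 \<le> y") auto
qed

lemma abs_le_cosh: "\<bar>y\<bar> \<le> cosh (y :: real)"
proof -
  have "2 * 1 * (\<bar>y\<bar> / 2) \<le> 1\<^sup>2 + (\<bar>y\<bar> / 2)\<^sup>2" by (rule sum_squares_bound)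
  then have "\<bar>y\<bar> \<le> 1 + y\<^sup>2 / 4" by (simp add: power_divide)
  then show ?thesis using cosh_ge_1_plus_square[of y] by simp
qed

lemma integrable_exp_cosh:
  fixes c r :: real
  assumes "0 < c"
  shows "integrable lborel (\<lambda>w. exp (- c * cosh (w - r)))"
proof -
  have "integrable lborel (\<lambda>x::real. inverse (1 + x\<^sup>2))"
    using integrable_inverse_1_plus_square by (simp add: set_integrable_def)
  from lborel_integrable_real_affine[OF this, of 1 "- r"]
  have i: "integrable lborel (\<lambda>x. 4 / c * inverse (1 + (x - r)\<^sup>2))"
    by (intro integrable_mult_right) simp
  have "(\<lambda>w. exp (- c * cosh (w - r))) \<in> borel_measurable borel"
    by (intro borel_measurable_continuous_onI continuous_intros)
  then have m: "(\<lambda>w. exp (- c * cosh (w - r))) \<in> borel_measurable lborel" by simp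
  show ?thesis
  proof (rule Bochner_Integration.integrable_bound[OF i m], rule AE_I2)
    fix w
    \<comment> \<open>The estimate exp(-t) <= 1/t turns the double exponential decay into a multiple
      of the Cauchy density, whose integrability is known.\<close>
    define t where "t = c * ((1 + (w - r)\<^sup>2) / 4)"
    have t: "0 < t" using assms by (auto simp: t_def intro!: mult_pos_pos add_pos_nonneg)
    have "exp (- c * cosh (w - r)) \<le> exp (- t)"
    proof -
      have "t \<le> c * cosh (w - r)"
        unfolding t_def using assms cosh_ge_1_plus_square[of "w - r"] by (intro mult_left_mono) auto
      then show ?thesis by simp
    qed
    also have "\<dots> \<le> 1 / t"
    proof -
      have "t \<le> exp t" using exp_ge_add_one_self[of t] by linarith
      then show ?thesis using t by (simp add: exp_minus field_simps)
    qed
    also have "\<dots> = 4 / c * inverse (1 + (w - r)\<^sup>2)" by (simp add: t_def inverse_eq_divide)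
    finally have "exp (- c * cosh (w - r)) \<le> 4 / c * inverse (1 + (w - r)\<^sup>2)" .
    then show "norm (exp (- c * cosh (w - r))) \<le> norm (4 / c * inverse (1 + (w - r)\<^sup>2))"
      using abs_ge_self[of "4 / c * inverse (1 + (w - r)\<^sup>2)"] by simp
  qed
qed

lemma integrable_bessel_kernel:
  assumes z: "0 < z" and d: "\<bar>Im d\<bar> < pi / 2"
  shows "integrable lborel (\<lambda>w. bessel_kernel u z (of_real w - d))"
proof -
  have c: "0 < cos (Im d)" using d by (intro cos_gt_zero_pi) auto
  have "integrable lborel (\<lambda>w. exp (u * Im d) * exp (- (z * cos (Im d)) * cosh (w - Re d)))"
    using z c by (intro integrable_mult_right integrable_exp_cosh) simp
  moreover
  have "(\<lambda>w. bessel_kernel u z (of_real w - d)) \<in> borel_measurable borel"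
    unfolding bessel_kernel_def cosh_def
    by (intro borel_measurable_continuous_onI continuous_intros)
  then have "(\<lambda>w. bessel_kernel u z (of_real w - d)) \<in> borel_measurable lborel" by simp
  ultimately show ?thesis
    by (rule Bochner_Integration.integrable_bound)
       (auto simp: norm_bessel_kernel mult_ac simp flip: exp_add intro!: AE_I2)
qed

lemma integral_symmetric_interval_tendsto:
  fixes f :: "real \<Rightarrow> complex"
  assumes "integrable lborel f"
  shows "(\<lambda>n. \<integral>w. indicator {- real n..real n} w *\<^sub>R f w \<partial>lborel) \<longlonglongrightarrow> (\<integral>w. f w \<partial>lborel)"
proof (rule integral_dominated_convergence)
  show "integrable lborel (\<lambda>w. norm (f w))" using assms by simp
  show "f \<in> borel_measurable lborel" using assms by simp
  then show "(\<lambda>w. indicator {- real n..real n} w *\<^sub>R f w) \<in> borel_measurable lborel" for n by simp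
  show "AE w in lborel. (\<lambda>n. indicator {- real n..real n} w *\<^sub>R f w) \<longlonglongrightarrow> f w"
  proof (rule AE_I2, rule tendsto_eventually)
    fix w :: real
    obtain N where "\<bar>w\<bar> \<le> real N" using real_arch_simple by blast
    then have "\<forall>n\<ge>N. indicator {- real n..real n} w *\<^sub>R f w = f w" by (auto simp: indicator_def)
    then show "\<forall>\<^sub>F n in sequentially. indicator {- real n..real n} w *\<^sub>R f w = f w"
      unfolding eventually_sequentially by blast
  qed
  show "AE w in lborel. norm (indicator {- real n..real n} w *\<^sub>R f w) \<le> norm (f w)" for n
    by (auto simp: indicator_def)
qed

text \<open>The kernel is entire and so has a global primitive G, which replaces a contour around a
  parallelogram. Truncated to [-n, n], the two integrals differ by increments of G along the end
  segments from n to n - d and from -n to -n - d, and these vanish as n grows. The argument treats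
  real and imaginary parts of d alike.\<close>

lemma integral_bessel_kernel_shift:
  assumes z: "0 < z" and d: "\<bar>Im d\<bar> < pi / 2"
  shows "(\<integral>w. bessel_kernel u z (of_real w - d) \<partial>lborel) = (\<integral>w. bessel_kernel u z (of_real w) \<partial>lborel)"
proof -
  let ?g = "bessel_kernel u z"
  have "?g holomorphic_on UNIV"
    unfolding bessel_kernel_def cosh_def by (intro holomorphic_intros)
  from holomorphic_convex_primitive'[OF convex_UNIV open_UNIV this]
  obtain G where G: "\<And>w. (G has_field_derivative ?g w) (at w)" by auto
  have cg: "continuous_on S ?g" for S
    unfolding bessel_kernel_def cosh_def by (intro continuous_intros) auto
  have ftc: "(\<integral>w. indicator {- real n..real n} w *\<^sub>R ?g (of_real w - e) \<partial>lborel) =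
      G (of_real (real n) - e) - G (of_real (- real n) - e)" for n e
  proof (rule integral_FTC_Icc)
    show "((\<lambda>w. G (of_real w - e)) has_vector_derivative ?g (of_real w - e)) (at w within {- real n..real n})" for w
    proof -
      have "((\<lambda>w. of_real w - e) has_vector_derivative 1) (at w within {- real n..real n})"
        by (auto intro!: derivative_eq_intros)
      from field_vector_diff_chain_within[OF this DERIV_subset[OF G]]
      show ?thesis by (simp add: o_def)
    qed
    show "continuous_on {- real n..real n} (\<lambda>w. ?g (of_real w - e))"
      by (intro continuous_on_compose2[OF cg[of UNIV]] continuous_intros) auto
  qed simp
  have c: "0 < cos (Im d)" using d by (intro cos_gt_zero_pi) auto
  \<comment> \<open>On an end segment |Im w| <= |Im d| < pi/2, hence cos(Im w) >= cos(Im d) > 0,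
    while cosh(Re w) >= |Re w| >= n - |d|. The term |u| pi/2 absorbs -u Im w.\<close>
  define B where "B = (\<lambda>n. exp (\<bar>u\<bar> * (pi / 2) - z * cos (Im d) * (real n - norm d)))"
  have diff: "norm (G (of_real p - d) - G (of_real p)) \<le> B n * norm d" if p: "\<bar>p\<bar> = real n" for p n
  proof -
    let ?S = "closed_segment (of_real p) (of_real p - d)"
    have bd: "norm (?g w) \<le> B n" if w: "w \<in> ?S" for w
    proof -
      from w obtain t where t: "0 \<le> t" "t \<le> 1" and weq: "w = (1 - t) *\<^sub>R of_real p + t *\<^sub>R (of_real p - d)"
        unfolding closed_segment_def by auto
      have weq: "w = of_real p - of_real t * d" unfolding weq by (simp add: scaleR_conv_of_real algebra_simps)
      have "\<bar>t * Im d\<bar> \<le> \<bar>Im d\<bar>" using t by (simp add: abs_mult mult_left_le_one_le)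
      then have im: "\<bar>Im w\<bar> \<le> \<bar>Im d\<bar>" by (simp add: weq)
      have "\<bar>t * Re d\<bar> \<le> \<bar>Re d\<bar>" using t by (simp add: abs_mult mult_left_le_one_le)
      also have "\<dots> \<le> norm d" by (rule abs_Re_le_cmod)
      finally have "real n - norm d \<le> \<bar>Re w\<bar>" using p by (simp add: weq)
      also have "\<dots> \<le> cosh (Re w)" by (rule abs_le_cosh)
      finally have re: "real n - norm d \<le> cosh (Re w)" .
      have "cos \<bar>Im d\<bar> \<le> cos \<bar>Im w\<bar>" using im d by (intro cos_monotone_0_pi_le) auto
      then have cc: "cos (Im d) \<le> cos (Im w)" by simp
      have "cos (Im d) * (real n - norm d) \<le> cos (Im d) * cosh (Re w)"
        using c re by (intro mult_left_mono) auto
      also have "\<dots> \<le> cos (Im w) * cosh (Re w)" using cc by (intro mult_right_mono) auto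
      finally have "z * (cos (Im d) * (real n - norm d)) \<le> z * (cos (Im w) * cosh (Re w))"
        using z by (intro mult_left_mono) auto
      moreover have "- u * Im w \<le> \<bar>u\<bar> * (pi / 2)"
      proof -
        have "- u * Im w \<le> \<bar>u\<bar> * \<bar>Im w\<bar>" by (metis abs_ge_self abs_minus_cancel abs_mult)
        also have "\<dots> \<le> \<bar>u\<bar> * (pi / 2)" using im d by (intro mult_left_mono) auto
        finally show ?thesis .
      qed
      ultimately show ?thesis by (simp add: norm_bessel_kernel B_def mult_ac)
    qed
    have "norm (G (of_real p - d) - G (of_real p)) \<le> B n * norm (of_real p - d - of_real p)"
      by (rule field_differentiable_bound[of ?S G ?g])
         (use bd in \<open>auto intro: has_field_derivative_at_within[OF G]\<close>)
    then show ?thesis by simp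
  qed
  have Blim: "(\<lambda>n. B n * norm d) \<longlonglongrightarrow> 0"
  proof -
    have "(\<lambda>n. exp (r - s * (real n - t))) \<longlonglongrightarrow> 0" if "0 < s" for r s t :: real
      using that by real_asymp
    then have "B \<longlonglongrightarrow> 0" unfolding B_def using z c by simp
    then show ?thesis by (rule tendsto_mult_left_zero)
  qed
  have e1: "(\<lambda>n. G (of_real (real n) - d) - G (of_real (real n))) \<longlonglongrightarrow> 0"
    by (rule Lim_null_comparison[OF _ Blim]) (intro always_eventually allI diff, simp)
  have e2: "(\<lambda>n. G (of_real (- real n) - d) - G (of_real (- real n))) \<longlonglongrightarrow> 0"
    by (rule Lim_null_comparison[OF _ Blim]) (intro always_eventually allI diff, simp)
  have "(\<lambda>n. (\<integral>w. indicator {- real n..real n} w *\<^sub>R ?g (of_real w - d) \<partial>lborel) -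
      (\<integral>w. indicator {- real n..real n} w *\<^sub>R ?g (of_real w - 0) \<partial>lborel)) \<longlonglongrightarrow> 0"
    unfolding ftc using tendsto_diff[OF e1 e2] by (simp add: algebra_simps)
  moreover have "(\<lambda>n. (\<integral>w. indicator {- real n..real n} w *\<^sub>R ?g (of_real w - d) \<partial>lborel) -
      (\<integral>w. indicator {- real n..real n} w *\<^sub>R ?g (of_real w - 0) \<partial>lborel)) \<longlonglongrightarrow>
      (\<integral>w. ?g (of_real w - d) \<partial>lborel) - (\<integral>w. ?g (of_real w - 0) \<partial>lborel)"
    using z d by (intro tendsto_diff integral_symmetric_interval_tendsto integrable_bessel_kernel) auto
  ultimately show ?thesis using LIMSEQ_unique by fastforce
qed

text \<open>The integrand on the half-line is the even part of the kernel, so reflecting one of its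
  two terms unfolds the half-line to the full line. The absolute value of u disappears because cosh
  is even.\<close>

lemma bessel_K_eq_integral:
  assumes z: "0 < z"
  shows "bessel_K (\<i> * of_real \<bar>u\<bar>) z = (\<integral>w. bessel_kernel u z (of_real w) \<partial>lborel) / 2"
proof -
  let ?g = "\<lambda>w::real. bessel_kernel u z (of_real w)"
  have ig: "integrable lborel ?g" using integrable_bessel_kernel[OF z, of 0 u] by simp
  have ig': "integrable lborel (\<lambda>w. ?g (- w))"
    using lborel_integrable_real_affine[OF ig, of "-1" 0] by simp
  define h where "h = (\<lambda>w::real. complex_of_real (exp (- z * cosh w)) * cosh (\<i> * of_real \<bar>u\<bar> * of_real w))"
  have h: "h w = (?g w + ?g (- w)) / 2" for w
  proof -
    have "cosh (\<i> * of_real \<bar>u\<bar> * of_real w) = cosh (\<i> * of_real u * of_real w)"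
      by (cases "0 \<le> u") auto
    moreover have "cosh (\<i> * of_real u * of_real w) = (exp (\<i> * of_real u * of_real w) + exp (- (\<i> * of_real u * of_real w))) / 2"
      by (simp add: cosh_def scaleR_conv_of_real)
    moreover have "complex_of_real (exp (- z * cosh w)) = exp (- of_real z * cosh (of_real w))"
    proof -
      have "cosh (complex_of_real w) = of_real (cosh w)"
        by (simp add: cosh_def scaleR_conv_of_real flip: exp_of_real)
      then show ?thesis by (simp flip: exp_of_real)
    qed
    ultimately have "h w = exp (- of_real z * cosh (of_real w)) * ((exp (\<i> * of_real u * of_real w) + exp (- (\<i> * of_real u * of_real w))) / 2)"
      by (simp only: h_def)
    then show ?thesis
      by (simp add: bessel_kernel_def exp_diff exp_minus field_simps)
  qed
  have "set_integrable lborel {0..} h"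
    unfolding set_integrable_def h using ig ig'
    by (intro integrable_mult_indicator) auto
  then have "bessel_K (\<i> * of_real \<bar>u\<bar>) z = (\<integral>w\<in>{0..}. h w \<partial>lborel)"
    unfolding bessel_K_def h_def by (rule set_borel_integral_eq_integral(2)[symmetric])
  also have "\<dots> = (\<integral>w. (indicator {0..} w *\<^sub>R ?g w + indicator {0..} w *\<^sub>R ?g (- w)) / 2 \<partial>lborel)"
    unfolding set_lebesgue_integral_def h
    by (intro Bochner_Integration.integral_cong refl) (simp add: scaleR_conv_of_real algebra_simps)
  also have "\<dots> = ((\<integral>w. indicator {0..} w *\<^sub>R ?g w \<partial>lborel) + (\<integral>w. indicator {0..} w *\<^sub>R ?g (- w) \<partial>lborel)) / 2"
    using ig ig' by (subst integral_divide_zero, subst Bochner_Integration.integral_add)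
      (auto intro!: integrable_mult_indicator)
  also have "(\<integral>w. indicator {0..} w *\<^sub>R ?g (- w) \<partial>lborel) = (\<integral>w. indicator {0..} (- w) *\<^sub>R ?g w \<partial>lborel)"
    using lborel_integral_real_affine[of "-1" "\<lambda>w. indicator {0..} w *\<^sub>R ?g (- w)" 0] by simp
  also have "(\<integral>w. indicator {0..} w *\<^sub>R ?g w \<partial>lborel) + \<dots> =
      (\<integral>w. indicator {0..} w *\<^sub>R ?g w + indicator {0..} (- w) *\<^sub>R ?g w \<partial>lborel)"
  proof (rule Bochner_Integration.integral_add[symmetric])
    show "integrable lborel (\<lambda>w. indicator {0..} w *\<^sub>R ?g w)"
      using ig by (intro integrable_mult_indicator) auto
    have "integrable lborel (\<lambda>w. indicator {..0::real} w *\<^sub>R ?g w)"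
      using ig by (intro integrable_mult_indicator) auto
    moreover have "indicator {0..} (- w) = (indicator {..0} w :: real)" for w :: real
      by (auto simp: indicator_def)
    ultimately show "integrable lborel (\<lambda>w. indicator {0..} (- w) *\<^sub>R ?g w)" by simp
  qed
  also have "\<dots> = (\<integral>w. ?g w \<partial>lborel)"
  proof (rule integral_cong_AE)
    \<comment> \<open>At w = 0 both indicators equal one and the kernel is counted twice; this
      single point is a null set.\<close>
    show "AE w in lborel. indicator {0..} w *\<^sub>R ?g w + indicator {0..} (- w) *\<^sub>R ?g w = ?g w"
      using AE_lborel_singleton[of "0::real"] by eventually_elim (auto simp: indicator_def)
  qed (use ig in auto)
  finally show ?thesis .
qed

section \<open>Passage to the integral\<close>

text \<open>Index j occupies a cell of width 2/M starting at (2j - n)/M, the number multiplying iu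
  in the phase. Sums with a growing number of terms thereby become integrals over one fixed line;
  half-open cells make at most one index active at each point.\<close>

definition step_function :: "(nat \<Rightarrow> complex) \<Rightarrow> nat \<Rightarrow> real \<Rightarrow> real \<Rightarrow> complex" where
  "step_function f n M w = (\<Sum>j\<le>n. indicator {(2 * real j - real n) / M..<(2 * real j - real n + 2) / M} w *\<^sub>R f j)"

lemma step_function_eq:
  assumes "0 < M"
  shows "step_function f n M w =
    (let j = \<lfloor>(M * w + real n) / 2\<rfloor> in if 0 \<le> j \<and> j \<le> int n then f (nat j) else 0)"
proof -
  define j where "j = \<lfloor>(M * w + real n) / 2\<rfloor>"
  have mem: "w \<in> {(2 * real k - real n) / M..<(2 * real k - real n + 2) / M} \<longleftrightarrow> j = int k" for k
  proof -
    have "w \<in> {(2 * real k - real n) / M..<(2 * real k - real n + 2) / M} \<longleftrightarrow>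
        real k \<le> (M * w + real n) / 2 \<and> (M * w + real n) / 2 < real k + 1"
      using assms by (auto simp: field_simps)
    also have "\<dots> \<longleftrightarrow> j = int k" by (auto simp: j_def floor_eq_iff)
    finally show ?thesis .
  qed
  have "step_function f n M w = (\<Sum>k\<le>n. if j = int k then f k else 0)"
    unfolding step_function_def indicator_def mem by (intro sum.cong) auto
  also have "\<dots> = (if 0 \<le> j \<and> j \<le> int n then f (nat j) else 0)"
  proof (cases "0 \<le> j")
    case True
    then have "(j = int k) = (nat j = k)" for k by auto
    then show ?thesis using True by (auto simp: nat_le_iff)
  qed (auto intro!: sum.neutral)
  finally show ?thesis by (simp add: j_def Let_def)
qed

lemma integral_step_function:
  assumes "0 < M"
  shows "(\<integral>w. step_function f n M w \<partial>lborel) = of_real (2 / M) * (\<Sum>j\<le>n. f j)"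
proof -
  have "(\<integral>w. step_function f n M w \<partial>lborel) =
      (\<Sum>j\<le>n. \<integral>w. indicator {(2 * real j - real n) / M..<(2 * real j - real n + 2) / M} w *\<^sub>R f j \<partial>lborel)"
    unfolding step_function_def
    by (intro Bochner_Integration.integral_sum integrable_scaleR_left impI integrable_real_indicator
        emeasure_bounded_finite bounded_Ico) simp_all
  also have "\<dots> = (\<Sum>j\<le>n. (2 / M) *\<^sub>R f j)"
  proof (intro sum.cong refl)
    fix j
    have "(2 * real j - real n) / M \<le> (2 * real j - real n + 2) / M"
      using assms by (intro divide_right_mono) auto
    moreover have "(2 * real j - real n + 2) / M - (2 * real j - real n) / M = 2 / M"
      by (simp add: diff_divide_distrib[symmetric])
    ultimately show "(\<integral>w. indicator {(2 * real j - real n) / M..<(2 * real j - real n + 2) / M} w *\<^sub>R f j \<partial>lborel)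
        = (2 / M) *\<^sub>R f j"
      by simp
  qed
  finally show ?thesis by (simp add: scaleR_conv_of_real sum_distrib_left)
qed

lemma borel_measurable_step_function [measurable]: "step_function f n M \<in> borel_measurable borel"
  unfolding step_function_def[abs_def] by measurable

lemma base_power: "base M ^ n = exp (- (2 * real n) / M)"
  by (simp add: base_def exp_of_nat_mult[symmetric])

section \<open>Limit and domination of the summands for fixed parameters\<close>

context
  fixes a b :: complex and x :: real
  assumes a: "0 \<le> Re a" and b: "0 \<le> Re b" and ab: "Im (Ln (1 + a) + Ln (1 + b)) = 0"
begin

text \<open>The logarithm of sqrt((1 + a)(1 + b)), written with principal logarithms; by
  \<open>ab\<close> their sum is real, so taking the real part loses nothing.\<close>

definition log_mean :: real where
  "log_mean = Re (Ln (1 + a) + Ln (1 + b)) / 2"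

definition log_skew :: complex where
  "log_skew = (Ln (1 + a) - Ln (1 + b)) / 2"

lemma parameters_nonzero: "1 + a \<noteq> 0" "1 + b \<noteq> 0"
  using a b by (metis Re_1_plus_ge(2)[of _ 1] mult.right_neutral norm_zero not_one_le_zero of_real_1 zero_le_one)+

lemma log_mean_complex: "complex_of_real log_mean = (Ln (1 + a) + Ln (1 + b)) / 2"
  using ab by (simp add: log_mean_def complex_eq_iff)

text \<open>Scaled by the geometric mean, 1 + a and 1 + b become reciprocal. This lets the two
  one-sided exponents merge into a single shifted cosh.\<close>

lemma exp_log_skew:
  "exp log_skew = (1 + a) * of_real (exp (- log_mean))"
  "exp (- log_skew) = (1 + b) * of_real (exp (- log_mean))"
proof -
  have "log_skew = Ln (1 + a) - of_real log_mean" "- log_skew = Ln (1 + b) - of_real log_mean"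
    by (simp_all add: log_mean_complex log_skew_def field_simps)
  then show "exp log_skew = (1 + a) * of_real (exp (- log_mean))"
    "exp (- log_skew) = (1 + b) * of_real (exp (- log_mean))"
    by (simp_all only: exp_diff exp_minus exp_of_real of_real_inverse divide_inverse
        exp_Ln[OF parameters_nonzero(1)] exp_Ln[OF parameters_nonzero(2)])
qed

text \<open>Half the difference of two angles, each strictly below pi/2 in absolute value.
  Strictness is what the contour shift requires.\<close>

lemma Im_log_skew: "\<bar>Im log_skew\<bar> < pi / 2"
proof -
  have "\<bar>Im (Ln (1 + a))\<bar> < pi / 2" "\<bar>Im (Ln (1 + b))\<bar> < pi / 2"
    using Re_Ln_pos_lt[OF parameters_nonzero(1)] Re_Ln_pos_lt[OF parameters_nonzero(2)] a b by auto
  then show ?thesis by (simp add: log_skew_def)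
qed

lemma scaled_index_eq:
  assumes "0 < M"
  shows "scaled_index a b x M = nat (\<lfloor>M * x\<rfloor> + \<lfloor>M * (ln M + log_mean)\<rfloor>)"
proof -
  have "(1 + a) * (1 + b) = exp (Ln (1 + a) + Ln (1 + b))"
    using parameters_nonzero by (simp add: exp_add)
  also have "Ln (1 + a) + Ln (1 + b) = of_real (2 * log_mean)"
    by (simp add: log_mean_complex)
  finally have "Re ((1 + a) * (1 + b)) = exp (2 * log_mean)"
    by (simp only: exp_of_real Re_complex_of_real)
  also have "\<dots> = (exp log_mean)\<^sup>2" by (simp add: exp_double)
  finally have "sqrt (Re ((1 + a) * (1 + b))) = exp log_mean" by simp
  then show ?thesis using assms by (simp add: scaled_index_def ln_mult)
qed

text \<open>A positive index shows that \<open>nat\<close> did not truncate, and floors only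
  decrease; hence there is no additive error on this side.\<close>

lemma scaled_index_upper:
  assumes "0 < M" "0 < scaled_index a b x M"
  shows "real (scaled_index a b x M) \<le> M * (x + ln M + log_mean)"
proof -
  have "real (scaled_index a b x M) = of_int (\<lfloor>M * x\<rfloor> + \<lfloor>M * (ln M + log_mean)\<rfloor>)"
    using assms by (simp add: scaled_index_eq)
  also have "\<dots> \<le> M * x + M * (ln M + log_mean)" by (simp add: add_mono)
  finally show ?thesis by (simp add: algebra_simps)
qed

lemma eventually_scaled_index:
  "eventually (\<lambda>M. \<bar>real (scaled_index a b x M) - M * (x + ln M + log_mean)\<bar> \<le> 2) at_top"
proof -
  have "eventually (\<lambda>M. 2 \<le> M * (x + ln M + log_mean)) at_top" by real_asymp
  with eventually_gt_at_top[of 0] show ?thesis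
  proof eventually_elim
    case (elim M)
    define i where "i = \<lfloor>M * x\<rfloor> + \<lfloor>M * (ln M + log_mean)\<rfloor>"
    have i: "M * (x + ln M + log_mean) - 2 \<le> of_int i" "of_int i \<le> M * (x + ln M + log_mean)"
      unfolding i_def by (simp_all add: algebra_simps) linarith+
    then have "0 \<le> i" using elim by linarith
    then have "real (scaled_index a b x M) = of_int i"
      using elim by (simp add: scaled_index_eq i_def)
    then show ?case using i by (simp add: abs_le_iff)
  qed
qed

definition summand :: "real \<Rightarrow> real \<Rightarrow> nat \<Rightarrow> complex" where
  "summand u M j = (let n = scaled_index a b x M in
     kernel_factor a (- \<i> * of_real u) M j * kernel_factor b (\<i> * of_real u) M (n - j)
       * exp (\<i> * of_real (u * (2 * real j - real n) / M)))"

definition lower_index :: "real \<Rightarrow> real \<Rightarrow> nat" where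
  "lower_index w M = nat \<lfloor>(M * w + real (scaled_index a b x M)) / 2\<rfloor>"

text \<open>The index n is within 2 of its target, so half of it is within 1, and the floor defining
  j loses at most 1 more: error 2 for j. The bound 4 for n - j adds the errors of n and j.\<close>

lemma eventually_step_function_eq:
  "eventually (\<lambda>M. step_function (summand u M) (scaled_index a b x M) M w = summand u M (lower_index w M)
     \<and> \<bar>real (lower_index w M) - M * (w + x + ln M + log_mean) / 2\<bar> \<le> 2
     \<and> \<bar>real (scaled_index a b x M - lower_index w M) - M * (x + ln M + log_mean - w) / 2\<bar> \<le> 4
     \<and> lower_index w M \<le> scaled_index a b x M) at_top"
proof -
  \<comment> \<open>These thresholds place y between 1 and n - 1 even after n has moved by 2, so the
    cell index is in range.\<close>
  have "eventually (\<lambda>M. 4 \<le> M * (w + x + ln M + log_mean)) at_top"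
    "eventually (\<lambda>M. 8 \<le> M * (x + ln M + log_mean - w)) at_top" by real_asymp+
  with eventually_gt_at_top[of 0] eventually_scaled_index show ?thesis
  proof eventually_elim
    case (elim M)
    define n where "n = scaled_index a b x M"
    define y where "y = (M * w + real n) / 2"
    have n: "\<bar>real n - M * (x + ln M + log_mean)\<bar> \<le> 2" using elim by (simp add: n_def)
    have e1: "M * (w + x + ln M + log_mean) = M * w + M * (x + ln M + log_mean)"
      and e2: "M * (x + ln M + log_mean - w) = M * (x + ln M + log_mean) - M * w"
      by (simp_all add: algebra_simps)
    \<comment> \<open>The products with M are abstracted to W and T, which leaves linear
      arithmetic.\<close>
    have "1 \<le> (W + r) / 2" if "4 \<le> W + T" "\<bar>r - T\<bar> \<le> 2" for W T r :: real
      using that by (auto simp: abs_le_iff)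
    from this[OF elim(3)[unfolded e1] n] have "1 \<le> y" by (simp add: y_def)
    moreover
    have "(W + r) / 2 \<le> r - 1" if "8 \<le> T - W" "\<bar>r - T\<bar> \<le> 2" for W T r :: real
      using that by (auto simp: abs_le_iff)
    from this[OF elim(4)[unfolded e2] n] have "y \<le> real n - 1" by (simp add: y_def)
    ultimately have f: "0 \<le> \<lfloor>y\<rfloor>" "\<lfloor>y\<rfloor> \<le> int n" by linarith+
    have j: "lower_index w M = nat \<lfloor>y\<rfloor>" by (simp add: lower_index_def y_def n_def)
    have rj: "real (lower_index w M) = of_int \<lfloor>y\<rfloor>" using f by (simp add: j)
    have jn: "lower_index w M \<le> n" using f by (simp add: j nat_le_iff)
    have "step_function (summand u M) n M w = summand u M (lower_index w M)"
      using f by (simp add: step_function_eq[OF elim(1)] Let_def j flip: y_def)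
    moreover
    have "\<bar>k - (W + T) / 2\<bar> \<le> 2 \<and> \<bar>r - k - (T - W) / 2\<bar> \<le> 4"
      if "\<bar>r - T\<bar> \<le> 2" "k \<le> (W + r) / 2" "(W + r) / 2 - 1 \<le> k" for W T r k :: real
      using that by (auto simp: abs_le_iff field_simps)
    from this[OF n, of "of_int \<lfloor>y\<rfloor>" "M * w"]
    have "\<bar>real (lower_index w M) - M * (w + x + ln M + log_mean) / 2\<bar> \<le> 2"
      "\<bar>real (n - lower_index w M) - M * (x + ln M + log_mean - w) / 2\<bar> \<le> 4"
      unfolding of_nat_diff[OF jn] rj e1 e2 using of_int_floor_le[of y] real_of_int_floor_gt_diff_one[of y]
      by (simp_all flip: y_def)
    ultimately show ?case using jn by (simp add: n_def)
  qed
qed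

text \<open>Since q^j = exp(-2j/M), the term M ln M / 2 in j cancels the factor M, and a bounded
  error in j changes the exponent only by O(1/M). This explains the logarithm in the index.\<close>

lemma scaled_base_power_tendsto:
  fixes j :: "real \<Rightarrow> nat"
  assumes "eventually (\<lambda>M. \<bar>real (j M) - M * (ln M + c) / 2\<bar> \<le> C) at_top"
  shows "((\<lambda>M. M * base M ^ j M) \<longlongrightarrow> exp (- c)) at_top"
proof -
  have "((\<lambda>M. 2 * (real (j M) - M * (ln M + c) / 2) / M) \<longlongrightarrow> 0) at_top"
  proof (rule Lim_null_comparison)
    show "((\<lambda>M::real. 2 * C / M) \<longlongrightarrow> 0) at_top"
      by real_asymp
    show "\<forall>\<^sub>F M in at_top. norm (2 * (real (j M) - M * (ln M + c) / 2) / M) \<le> 2 * C / M"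
      using assms eventually_gt_at_top[of 0]
    proof eventually_elim
      case (elim M)
      then have "2 * \<bar>real (j M) - M * (ln M + c) / 2\<bar> / M \<le> 2 * C / M"
        by (intro divide_right_mono) auto
      moreover have "norm (2 * (real (j M) - M * (ln M + c) / 2) / M) = 2 * \<bar>real (j M) - M * (ln M + c) / 2\<bar> / M"
        using elim(2) unfolding real_norm_def abs_divide abs_mult by simp
      ultimately show ?case by simp
    qed
  qed
  then have "((\<lambda>M. exp (- c - 2 * (real (j M) - M * (ln M + c) / 2) / M)) \<longlongrightarrow> exp (- c - 0)) at_top"
    by (intro tendsto_intros)
  moreover have "\<forall>\<^sub>F M in at_top. exp (- c - 2 * (real (j M) - M * (ln M + c) / 2) / M) = M * base M ^ j M"
    using eventually_gt_at_top[of 0]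
  proof eventually_elim
    case (elim M)
    have "- c - 2 * (real (j M) - M * (ln M + c) / 2) / M = ln M + - (2 * real (j M)) / M"
      using elim by (simp add: field_simps)
    then show ?case using elim by (simp only: exp_add exp_ln base_power)
  qed
  ultimately show ?thesis using Lim_transform_eventually by fastforce
qed

text \<open>The two halves contribute -exp(-x) exp(-(w - d))/2 and -exp(-x) exp(w - d)/2 to the
  exponent, with d = \<open>log_skew\<close>, which add up to the cosh term. The logarithms from the
  relative shifts contribute -iud and complete the phase iuw to iu(w - d).\<close>

lemma step_function_tendsto:
  "((\<lambda>M. step_function (summand u M) (scaled_index a b x M) M w) \<longlongrightarrow>
     bessel_kernel u (exp (- x)) (of_real w - log_skew)) at_top"
proof -
  let ?j = "lower_index w" and ?n = "scaled_index a b x"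
  have "((\<lambda>M. M * base M ^ ?j M) \<longlongrightarrow> exp (- (w + x + log_mean))) at_top"
    by (rule scaled_base_power_tendsto[of _ _ 2])
       (use eventually_step_function_eq[of u w] in \<open>auto elim!: eventually_mono simp: algebra_simps\<close>)
  from kernel_factor_tendsto[OF a this, of "- \<i> * of_real u"]
  have 1: "((\<lambda>M. kernel_factor a (- \<i> * of_real u) M (?j M)) \<longlongrightarrow>
      exp (- \<i> * of_real u / 2 * Ln (1 + a) - (1 + a) * of_real (exp (- (w + x + log_mean))) / 2)) at_top" .
  have "((\<lambda>M. M * base M ^ (?n M - ?j M)) \<longlongrightarrow> exp (- (x + log_mean - w))) at_top"
    by (rule scaled_base_power_tendsto[of _ _ 4])
       (use eventually_step_function_eq[of u w] in \<open>auto elim!: eventually_mono simp: algebra_simps\<close>)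
  from kernel_factor_tendsto[OF b this, of "\<i> * of_real u"]
  have 2: "((\<lambda>M. kernel_factor b (\<i> * of_real u) M (?n M - ?j M)) \<longlongrightarrow>
      exp (\<i> * of_real u / 2 * Ln (1 + b) - (1 + b) * of_real (exp (- (x + log_mean - w))) / 2)) at_top" .
  have "((\<lambda>M. (2 * real (?j M) - real (?n M)) / M - w) \<longlongrightarrow> 0) at_top"
  proof (rule Lim_null_comparison)
    \<comment> \<open>Writing 2j - n as j - (n - j) adds the errors 2 and 4.\<close>
    show "((\<lambda>M::real. 6 / M) \<longlongrightarrow> 0) at_top" by real_asymp
    show "\<forall>\<^sub>F M in at_top. norm ((2 * real (?j M) - real (?n M)) / M - w) \<le> 6 / M"
      using eventually_step_function_eq[of u w] eventually_gt_at_top[of 0]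
    proof eventually_elim
      case (elim M)
      have e: "M * (w + x + ln M + log_mean) = M * (x + ln M + log_mean - w) + 2 * (M * w)"
        by (simp add: algebra_simps)
      have "?j M \<le> ?n M" using elim(1) by blast
      then have d: "real (?n M - ?j M) = real (?n M) - real (?j M)" by (rule of_nat_diff)
      have h1: "\<bar>real (?j M) - M * (w + x + ln M + log_mean) / 2\<bar> \<le> 2"
        and h2: "\<bar>real (?n M - ?j M) - M * (x + ln M + log_mean - w) / 2\<bar> \<le> 4"
        using elim(1) by blast+
      have "\<bar>(2 * real (?j M) - real (?n M)) - M * w\<bar> \<le> 6"
      proof -
        have "\<bar>2 * r - s - W\<bar> \<le> 6" if "\<bar>r - (X + 2 * W) / 2\<bar> \<le> 2" "\<bar>s - r - X / 2\<bar> \<le> 4"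
          for r s X W :: real
          using that by (auto simp: abs_le_iff field_simps)
        from this[OF h1[unfolded e] h2[unfolded d]] show ?thesis .
      qed
      then have "\<bar>(2 * real (?j M) - real (?n M)) - M * w\<bar> / M \<le> 6 / M"
        using elim(2) by (intro divide_right_mono) auto
      moreover have "(2 * real (?j M) - real (?n M)) / M - w = ((2 * real (?j M) - real (?n M)) - M * w) / M"
        using elim(2) by (simp add: diff_divide_distrib)
      ultimately show ?case using elim(2) by (simp add: abs_divide)
    qed
  qed
  then have "((\<lambda>M. (2 * real (?j M) - real (?n M)) / M) \<longlongrightarrow> w) at_top"
    by (simp add: LIM_zero_iff)
  then have "((\<lambda>M. exp (\<i> * of_real (u * ((2 * real (?j M) - real (?n M)) / M)))) \<longlongrightarrow> exp (\<i> * of_real (u * w))) at_top"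
    by (intro tendsto_intros)
  then have 3: "((\<lambda>M. exp (\<i> * of_real (u * (2 * real (?j M) - real (?n M)) / M))) \<longlongrightarrow> exp (\<i> * of_real (u * w))) at_top"
    by simp
  have lim: "((\<lambda>M. summand u M (?j M)) \<longlongrightarrow>
      exp (- \<i> * of_real u / 2 * Ln (1 + a) - (1 + a) * of_real (exp (- (w + x + log_mean))) / 2) *
      exp (\<i> * of_real u / 2 * Ln (1 + b) - (1 + b) * of_real (exp (- (x + log_mean - w))) / 2) *
      exp (\<i> * of_real (u * w))) at_top"
    unfolding summand_def Let_def by (intro tendsto_mult 1 2 3)
  have ca: "(1 + a) * of_real (exp (- (w + x + log_mean))) = of_real (exp (- x)) * exp (- (of_real w - log_skew))"
  proof -
    have "exp (- (w + x + log_mean)) = exp (- log_mean) * exp (- x) * exp (- w)" by (simp flip: exp_add)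
    moreover have "exp (- (of_real w - log_skew)) = exp log_skew * of_real (exp (- w))"
      by (simp add: exp_diff exp_minus exp_of_real divide_inverse)
    ultimately show ?thesis unfolding exp_log_skew by simp
  qed
  have cb: "(1 + b) * of_real (exp (- (x + log_mean - w))) = of_real (exp (- x)) * exp (of_real w - log_skew)"
  proof -
    have "exp (- (x + log_mean - w)) = exp (- log_mean) * exp (- x) * exp w" by (simp flip: exp_add)
    moreover have "exp (of_real w - log_skew) = exp (- log_skew) * of_real (exp w)"
      by (simp add: exp_diff exp_minus exp_of_real divide_inverse)
    ultimately show ?thesis unfolding exp_log_skew by simp
  qed
  have "exp (- \<i> * of_real u / 2 * Ln (1 + a) - (1 + a) * of_real (exp (- (w + x + log_mean))) / 2) *
      exp (\<i> * of_real u / 2 * Ln (1 + b) - (1 + b) * of_real (exp (- (x + log_mean - w))) / 2) *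
      exp (\<i> * of_real (u * w)) = bessel_kernel u (exp (- x)) (of_real w - log_skew)"
    unfolding ca cb bessel_kernel_def exp_add[symmetric]
    by (rule arg_cong[of _ _ exp])
       (simp add: log_skew_def cosh_def scaleR_conv_of_real algebra_simps add_divide_distrib diff_divide_distrib)
  note lim[unfolded this]
  moreover have "\<forall>\<^sub>F M in at_top. summand u M (?j M) = step_function (summand u M) (?n M) M w"
    using eventually_step_function_eq[of u w] by eventually_elim simp
  ultimately show ?thesis by (rule Lim_transform_eventually)
qed

text \<open>The pointwise limit holds from a threshold depending on w, whereas domination must hold
  for all w at once. It uses only lower bounds for M q^(j+1) and M q^(n-j+1), which need no more
  than the upper bound on n; points outside the range of cells give zero.\<close>

lemma step_function_bound:
  obtains C c where "0 < c"
    "eventually (\<lambda>M. \<forall>w. norm (step_function (summand u M) (scaled_index a b x M) M w) \<le> C * exp (- c * cosh w)) at_top"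
proof -
  obtain A where A: "A > 0"
    "eventually (\<lambda>M. \<forall>j. norm (kernel_factor a (- \<i> * of_real u) M j) \<le> A * exp (- (M / 2) * base M ^ Suc j)) at_top"
    using kernel_factor_bound[OF a] by blast
  obtain B where B: "B > 0"
    "eventually (\<lambda>M. \<forall>j. norm (kernel_factor b (\<i> * of_real u) M j) \<le> B * exp (- (M / 2) * base M ^ Suc j)) at_top"
    using kernel_factor_bound[OF b] by blast
  \<comment> \<open>For M >= 1, rounding to a cell and passing from k to \<open>Suc k\<close> each
    lower the exponent by at most 2/M <= 2; together they account for the 4.\<close>
  define c where "c = exp (- x - log_mean - 4)"
  have "eventually (\<lambda>M. 2 \<le> M * (x + ln M + log_mean) - 1) at_top" by real_asymp
  with A(2) B(2) eventually_ge_at_top[of 1] eventually_scaled_index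
  have "eventually (\<lambda>M. \<forall>w. norm (step_function (summand u M) (scaled_index a b x M) M w) \<le> A * B * exp (- c * cosh w)) at_top"
  proof eventually_elim
    case (elim M)
    define n where "n = scaled_index a b x M"
    have "0 < real n" using elim(4,5) by (simp add: n_def abs_le_iff)
    then have n: "real n \<le> M * (x + ln M + log_mean)"
      using scaled_index_upper[of M] elim(3) by (simp add: n_def)
    show ?case
    proof
      fix w
      define y where "y = (M * w + real n) / 2"
      show "norm (step_function (summand u M) (scaled_index a b x M) M w) \<le> A * B * exp (- c * cosh w)"
      proof (cases "0 \<le> \<lfloor>y\<rfloor> \<and> \<lfloor>y\<rfloor> \<le> int n")
        case True
        define j where "j = nat \<lfloor>y\<rfloor>"
        have jn: "j \<le> n" using True by (simp add: j_def nat_le_iff)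
        have rj: "real j \<le> y" "y - 1 \<le> real j" using True by (simp_all add: j_def)
        \<comment> \<open>The slack of 2 is needed for k = n - j, where rounding j down makes 2(n -
          j) larger by up to 2.\<close>
        have lb: "c * exp v \<le> M * base M ^ Suc k" if "2 * real k \<le> M * (x + ln M + log_mean - v) + 2" for k v
        proof -
          have "2 * real k / M \<le> (M * (x + ln M + log_mean - v) + 2) / M"
            using that elim(3) by (intro divide_right_mono) auto
          also have "\<dots> = x + ln M + log_mean - v + 2 / M" using elim(3) by (simp add: field_simps)
          finally have *: "2 * real k / M \<le> x + ln M + log_mean - v + 2 / M" .
          have "- x - log_mean - 4 + v \<le> ln M + - (2 * real (Suc k)) / M"
          proof -
            have "2 / M \<le> 2" using elim(3) by (simp add: divide_le_eq)
            moreover have "- (2 * real (Suc k)) / M = - (2 * real k / M) - 2 / M"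
              by (simp add: add_divide_distrib diff_divide_distrib)
            ultimately show ?thesis using * by linarith
          qed
          then have "exp (- x - log_mean - 4 + v) \<le> exp (ln M + - (2 * real (Suc k)) / M)" by simp
          moreover have "exp (ln M + - (2 * real (Suc k)) / M) = M * base M ^ Suc k"
            unfolding exp_add base_power using elim(3) by simp
          ultimately show ?thesis by (simp only: c_def exp_add)
        qed
        have 1: "c * exp (- w) \<le> M * base M ^ Suc j"
          by (rule lb) (use rj n in \<open>simp add: y_def algebra_simps\<close>)
        have 2: "c * exp w \<le> M * base M ^ Suc (n - j)"
          by (rule lb) (use rj n jn in \<open>simp add: y_def algebra_simps of_nat_diff\<close>)
        have "step_function (summand u M) n M w = summand u M j"
          using True elim(3) by (simp add: step_function_eq Let_def j_def flip: y_def)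
        also have "norm \<dots> = norm (kernel_factor a (- \<i> * of_real u) M j) * norm (kernel_factor b (\<i> * of_real u) M (n - j))"
          by (simp add: summand_def Let_def norm_mult norm_exp_eq_Re flip: n_def)
        also have "\<dots> \<le> (A * exp (- (M / 2) * base M ^ Suc j)) * (B * exp (- (M / 2) * base M ^ Suc (n - j)))"
          using elim(1,2) A(1) by (intro mult_mono) auto
        also have "\<dots> = A * B * exp (- ((M * base M ^ Suc j + M * base M ^ Suc (n - j)) / 2))"
          by (simp add: exp_add[symmetric] algebra_simps add_divide_distrib)
        also have "\<dots> \<le> A * B * exp (- c * cosh w)"
        proof -
          have "c * cosh w = (c * exp w + c * exp (- w)) / 2" by (simp add: cosh_def algebra_simps)
          also have "\<dots> \<le> (M * base M ^ Suc j + M * base M ^ Suc (n - j)) / 2" using 1 2 by simp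
          finally show ?thesis using A(1) B(1) by simp
        qed
        finally show ?thesis by (simp add: n_def)
      next
        case False
        then have "step_function (summand u M) n M w = 0"
          using elim(3) by (auto simp: step_function_eq Let_def simp flip: y_def)
        then show ?thesis using A(1) B(1) by (simp add: n_def)
      qed
    qed
  qed
  then show ?thesis by (intro that[of c "A * B"]) (simp_all add: c_def)
qed

text \<open>The mesh 2/M makes the sum divided by M half of the integral of the step function, and
  this half is the one in the full-line formula for the Macdonald function.\<close>

lemma scaled_polynomial_tendsto:
  "((\<lambda>M. (\<Sum>j\<le>scaled_index a b x M. summand u M j) / of_real M) \<longlongrightarrow>
      bessel_K (\<i> * of_real \<bar>u\<bar>) (exp (- x))) at_top"
proof -
  let ?s = "\<lambda>M. step_function (summand u M) (scaled_index a b x M) M"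
  obtain C c where c: "0 < c" and
    bnd: "eventually (\<lambda>M. \<forall>w. norm (?s M w) \<le> C * exp (- c * cosh w)) at_top"
    using step_function_bound by blast
  have "((\<lambda>M. \<integral>w. ?s M w \<partial>lborel) \<longlongrightarrow> (\<integral>w. bessel_kernel u (exp (- x)) (of_real w - log_skew) \<partial>lborel)) at_top"
  proof (rule integral_dominated_convergence_at_top)
    show "integrable lborel (\<lambda>w. C * exp (- c * cosh w))"
      using integrable_exp_cosh[OF c, of 0] by simp
    show "\<forall>\<^sub>F M in at_top. AE w in lborel. norm (?s M w) \<le> C * exp (- c * cosh w)"
      using bnd by eventually_elim auto
    show "AE w in lborel. ((\<lambda>M. ?s M w) \<longlongrightarrow> bessel_kernel u (exp (- x)) (of_real w - log_skew)) at_top"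
      by (intro AE_I2 step_function_tendsto)
    show "(\<lambda>w. bessel_kernel u (exp (- x)) (of_real w - log_skew)) \<in> borel_measurable lborel"
      using integrable_bessel_kernel[OF _ Im_log_skew] by (intro borel_measurable_integrable) simp
  qed simp
  also have "(\<integral>w. bessel_kernel u (exp (- x)) (of_real w - log_skew) \<partial>lborel) = 2 * bessel_K (\<i> * of_real \<bar>u\<bar>) (exp (- x))"
    by (simp add: integral_bessel_kernel_shift[OF _ Im_log_skew] bessel_K_eq_integral)
  finally have "((\<lambda>M. (\<integral>w. ?s M w \<partial>lborel) / 2) \<longlongrightarrow> 2 * bessel_K (\<i> * of_real \<bar>u\<bar>) (exp (- x)) / 2) at_top"
    by (intro tendsto_intros) simp_all
  then have "((\<lambda>M. (\<integral>w. ?s M w \<partial>lborel) / 2) \<longlongrightarrow> bessel_K (\<i> * of_real \<bar>u\<bar>) (exp (- x))) at_top"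
    by simp
  moreover have "\<forall>\<^sub>F M in at_top. (\<integral>w. ?s M w \<partial>lborel) / 2 = (\<Sum>j\<le>scaled_index a b x M. summand u M j) / of_real M"
    using eventually_gt_at_top[of 0]
    by eventually_elim (simp add: integral_step_function)
  ultimately show ?thesis by (rule Lim_transform_eventually)
qed

end

theorem theorem3p3:
  fixes a b :: complex and x u :: real
  assumes "a \<in> \<real>\<^sub>\<ge>\<^sub>0 \<and> b \<in> \<real>\<^sub>\<ge>\<^sub>0 \<or> b = cnj a \<and> 0 \<le> Re a"
  shows "((\<lambda>M::real.
            let m = scaled_index a b x M;
                q = complex_of_real (exp (- 2 / M));
                aM = - q * a;
                bM = - q * b
            in (qpoch_inf q q)\<^sup>2 / (complex_of_real M * qpoch_inf aM q * qpoch_inf bM q)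
               * (al_salam_chihara m (complex_of_real (cos (u / M))) aM bM q / qpoch q q m))
          \<longlongrightarrow> bessel_K (\<i> * complex_of_real \<bar>u\<bar>) (exp (- x))) at_top"
proof -
  have ra: "0 \<le> Re a" and rb: "0 \<le> Re b"
    using assms by (auto simp: complex_nonneg_Reals_iff)
  have ab: "Im (Ln (1 + a) + Ln (1 + b)) = 0"
    using assms
  proof
    assume "a \<in> \<real>\<^sub>\<ge>\<^sub>0 \<and> b \<in> \<real>\<^sub>\<ge>\<^sub>0"
    then obtain r s where "a = of_real r" "b = of_real s" "0 \<le> r" "0 \<le> s"
      by (auto simp: nonneg_Reals_def)
    then show ?thesis using Ln_of_real[of "1 + r"] Ln_of_real[of "1 + s"] by simp
  next
    assume *: "b = cnj a \<and> 0 \<le> Re a"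
    \<comment> \<open>Being off the branch cut lets the logarithm commute with conjugation, so the
      two logarithms are conjugate and their sum is real.\<close>
    then have "1 + a \<notin> \<real>\<^sub>\<le>\<^sub>0" by (auto simp: complex_nonpos_Reals_iff)
    then have "Ln (1 + b) = cnj (Ln (1 + a))" using * cnj_Ln[of "1 + a"] by simp
    then show ?thesis by simp
  qed
  note lim = scaled_polynomial_tendsto[OF ra rb ab, where u = u and x = x]
  show ?thesis
  proof (rule Lim_transform_eventually[OF lim])
    show "\<forall>\<^sub>F M in at_top. (\<Sum>j\<le>scaled_index a b x M. summand a b x u M j) / of_real M =
        (let m = scaled_index a b x M;
                q = complex_of_real (exp (- 2 / M));
                aM = - q * a;
                bM = - q * b
            in (qpoch_inf q q)\<^sup>2 / (complex_of_real M * qpoch_inf aM q * qpoch_inf bM q)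
               * (al_salam_chihara m (complex_of_real (cos (u / M))) aM bM q / qpoch q q m))"
      using eventually_gt_at_top[of 0]
    proof eventually_elim
      case (elim M)
      show ?case
        unfolding Let_def base_def[symmetric] normalized_polynomial_eq_sum[OF elim]
        unfolding summand_def[OF ra rb ab] Let_def ..
    qed
  qed
qed

end
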